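(* Let $p$ be an odd prime number and let $\lambda$ be a bar-partition, with $p$-bar core $\lambda_{(\overline p)}$ and associated $p$-bar cocore partition $\lambda^{[\overline p]}$. (i) If $\operatorname{sgn}(\lambda_{(\overline p)})=1$ or $\operatorname{sgn}(\lambda^{[\overline p]})=1$, then $$\tau(\lambda,\sigma_p)=\tau(\lambda_{(\overline p)},\sigma_p)\,\tau(\lambda^{[\overline p]},\sigma_p).$$ (ii) If $\operatorname{sgn}(\lambda_{(\overline p)})=-1$ and $\operatorname{sgn}(\lambda^{[\overline p]})=-1$, then $$\tau(\lambda,\sigma_p)=(-1)^{(p-1)/2}\,\tau(\lambda_{(\overline p)},\sigma_p)\,\tau(\lambda^{[\overline p]},\sigma_p).$$ (iii) If $f$ is any Galois automorphism of $\overline{\mathbb Q}$ over $\mathbb Q$ that acts trivially on the $p'$-roots of unity, then $$\tau(\lambda,f)=\tau(\lambda_{(\overline p)},f)\,\tau(\lambda^{[\overline p]},f).$$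
   Context: **Bar-partitions.** A bar-partition is a partition with pairwise distinct parts (the empty partition is allowed). $|\lambda|$ is the sum of the parts, $\ell(\lambda)$ the number of parts, $\operatorname{sgn}(\lambda)=(-1)^{|\lambda|-\ell(\lambda)}$. **$t$-bar Littlewood decomposition ($t$ odd positive; here $t=p$).** Let $\lambda$ be a bar-partition, $\mathbb N=\{0,1,2,\dots\}$. For $0\le r\le t-1$ let $X_r=\{x\in\mathbb N : tx+r \text{ is a part of }\lambda\}$. For $1\le r\le (t-1)/2$ put $M_r=X_r\cup\{-1-x : x\in\mathbb N,\ x\notin X_{t-r}\}\subset\mathbb Z$ (the black beads of the $r$-th runner of the twisted $t$-bar-abacus, the fence being between $-1$ and $0$), and $c_r=|X_r|-|X_{t-r}|$. The vector $(c_1,\dots,c_{(t-1)/2})$ is the $t$-bar characteristic vector of $\lambda$. The $t$-bar quotient is $\lambda^{(\overline t)}=(\lambda^0,\lambda^1,\dots,\lambda^{(t-1)/2})$, where $\lambda^0$ is the bar-partition whose set of parts is $X_0$, and, for $r\ge1$, $\lambda^r$ is the partition whose Frobenius symbol has set of arms $\{x\ge 0: x\in M_r-c_r\}$ and set of legs $\{x\ge 0: -1-x\notin M_r-c_r\}$ (with $M_r-c_r=\{m-c_r: m\in M_r\}$; these two sets have the same cardinality). The bar $t$-weight is $w_{\overline t}(\lambda)=\sum_{j=0}^{(t-1)/2}|\lambda^j|$. The $t$-bar core $\lambda_{(\overline t)}$ is the bar-partition whose parts are, for each $1\le r\le (t-1)/2$: $r,r+t,\dots,r+(c_r-1)t$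 if $c_r>0$; $(t-r),(t-r)+t,\dots,(t-r)+(|c_r|-1)t$ if $c_r<0$; nothing if $c_r=0$. A bar-partition is uniquely determined by its $t$-bar core and its $t$-bar quotient, and all pairs occur. The $t$-bar cocore partition $\lambda^{[\overline t]}$ associated with $\lambda$ is the bar-partition with empty $t$-bar core and the same $t$-bar quotient as $\lambda$; it has size $t\,w_{\overline t}(\lambda)$. **The automorphism $\sigma_p$.** $\sigma_p\in\operatorname{Gal}(\overline{\mathbb Q}/\mathbb Q)$ acts by $x\mapsto x^p$ on $p'$-roots of unity (roots of unity of order prime to $p$) and fixes every root of unity of $p$-power order. **The signs $\tau(\lambda,f)$.** For $\lambda=(\lambda_1,\dots,\lambda_k)$ a bar-partition of $n$, put $a_\lambda=\sqrt2\, i^{(n-k+1)/2}\sqrt{\lambda_1\cdots\lambda_k}$ if $\operatorname{sgn}(\lambda)=-1$, and $b_\lambda=i^{(n-k)/2}\sqrt{\lambda_1\cdots\lambda_k}$ if $\operatorname{sgn}(\lambda)=1$ (empty product equal to $1$). The square of each of these numbers is an integer. For a Galois automorphism $f$, $\tau(\lambda,f)\in\{-1,1\}$ is defined by $f(a_\lambda)=\tau(\lambda,f)a_\lambda$ if $\operatorname{sgn}(\lambda)=-1$ and $f(b_\lambda)=\tau(\lambda,f)b_\lambda$ if $\operatorname{sgn}(\lambda)=1$. (Up to sign, $a_\lambda$, resp. $b_\lambda$, is the nonzero value of the difference $\xi_\lambda^+-\xi_\lambda^-$ of the two associate spin characters labeled by $\lambda$ of the double cover of the symmetric, resp. alternating,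 group, so $f(\xi_\lambda^\pm)=\xi_\lambda^{\pm\tau(\lambda,f)}$.) *)

theory Defs
  imports "HOL-Computational_Algebra.Computational_Algebra"
begin

section \<open>Bar-partitions and partitions\<close>

text \<open>A bar-partition has pairwise distinct parts, so it is identified with its set of parts.\<close>

definition bar_partition :: "nat set \<Rightarrow> bool" where
  "bar_partition L \<longleftrightarrow> finite L \<and> 0 \<notin> L"

definition bar_size :: "nat set \<Rightarrow> nat" where
  "bar_size L = \<Sum>L"

text \<open>The length never exceeds the size for a bar-partition, so the subtraction does not truncate.\<close>

definition bar_sgn :: "nat set \<Rightarrow> int" where
  "bar_sgn L = (-1) ^ (bar_size L - card L)"

text \<open>An ordinary partition is the weakly decreasing sequence of its parts
  \<open>P 0 \<ge> P 1 \<ge> \<dots>\<close>, padded by zeros.\<close>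

definition int_partition :: "(nat \<Rightarrow> nat) \<Rightarrow> bool" where
  "int_partition P \<longleftrightarrow> antimono P \<and> finite {i. P i \<noteq> 0}"

definition conjugate :: "(nat \<Rightarrow> nat) \<Rightarrow> nat \<Rightarrow> nat" where
  "conjugate P j = card {i. j < P i}"

text \<open>The condition \<open>i < P i\<close> says that the diagonal box \<open>(i, i)\<close>
  belongs to the Young diagram.\<close>

definition frobenius_arms :: "(nat \<Rightarrow> nat) \<Rightarrow> nat set" where
  "frobenius_arms P = {P i - i - 1 | i. i < P i}"

definition frobenius_legs :: "(nat \<Rightarrow> nat) \<Rightarrow> nat set" where
  "frobenius_legs P = {conjugate P i - i - 1 | i. i < conjugate P i}"

definition partition_of_frobenius :: "nat set \<Rightarrow> nat set \<Rightarrow> nat \<Rightarrow> nat" where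
  "partition_of_frobenius A B =
     (THE P. int_partition P \<and> frobenius_arms P = A \<and> frobenius_legs P = B)"


section \<open>The bar Littlewood decomposition\<close>

definition bar_runner :: "nat \<Rightarrow> nat set \<Rightarrow> nat \<Rightarrow> nat set" where
  "bar_runner t L r = {x. t * x + r \<in> L}"

definition twisted_runner :: "nat \<Rightarrow> nat set \<Rightarrow> nat \<Rightarrow> int set" where
  "twisted_runner t L r =
     int ` bar_runner t L r \<union> {- 1 - int x | x. x \<notin> bar_runner t L (t - r)}"

definition bar_char :: "nat \<Rightarrow> nat set \<Rightarrow> nat \<Rightarrow> int" where
  "bar_char t L r = int (card (bar_runner t L r)) - int (card (bar_runner t L (t - r)))"

definition shifted_runner :: "nat \<Rightarrow> nat set \<Rightarrow> nat \<Rightarrow> int set" where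
  "shifted_runner t L r = (\<lambda>m. m - bar_char t L r) ` twisted_runner t L r"

definition quotient_component :: "nat \<Rightarrow> nat set \<Rightarrow> nat \<Rightarrow> (nat \<Rightarrow> nat)" where
  "quotient_component t L r =
     partition_of_frobenius
       {x. int x \<in> shifted_runner t L r}
       {x. - 1 - int x \<notin> shifted_runner t L r}"

definition bar_quotient :: "nat \<Rightarrow> nat set \<Rightarrow> nat set \<times> (nat \<Rightarrow> nat) list" where
  "bar_quotient t L =
     (bar_runner t L 0, map (quotient_component t L) [1..<(t - 1) div 2 + 1])"

definition bar_core :: "nat \<Rightarrow> nat set \<Rightarrow> nat set" where
  "bar_core t L =
     (\<Union>r\<in>{1..(t - 1) div 2}.
        if bar_char t L r > 0 then {r + j * t | j. int j < bar_char t L r}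
        else if bar_char t L r < 0 then {(t - r) + j * t | j. int j < \<bar>bar_char t L r\<bar>}
        else {})"

definition bar_cocore :: "nat \<Rightarrow> nat set \<Rightarrow> nat set" where
  "bar_cocore t L =
     (THE M. bar_partition M \<and> bar_core t M = {} \<and> bar_quotient t M = bar_quotient t L)"


section \<open>Galois automorphisms of the algebraic numbers\<close>

text \<open>The algebraic closure of the rationals is taken inside the complex numbers. An
  automorphism is a function on all of \<open>\<complex>\<close> of which only the restriction to the algebraic
  numbers matters.\<close>

definition Qbar :: "complex set" where
  "Qbar = {z. algebraic z}"

definition galois_aut :: "(complex \<Rightarrow> complex) \<Rightarrow> bool" where
  "galois_aut f \<longleftrightarrow>
     bij_betw f Qbar Qbar \<and>
     (\<forall>x\<in>Qbar. \<forall>y\<in>Qbar. f (x + y) = f x + f y \<and> f (x * y) = f x * f y) \<and>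
     (\<forall>q\<in>\<rat>. f q = q)"

definition p'_root_of_unity :: "nat \<Rightarrow> complex \<Rightarrow> bool" where
  "p'_root_of_unity p z \<longleftrightarrow> (\<exists>n>0. coprime n p \<and> z ^ n = 1)"

definition p_root_of_unity :: "nat \<Rightarrow> complex \<Rightarrow> bool" where
  "p_root_of_unity p z \<longleftrightarrow> (\<exists>k. z ^ (p ^ k) = 1)"

text \<open>These conditions determine an automorphism on the roots of unity only; the predicate
  holds of every extension to the algebraic numbers.\<close>

definition is_sigma :: "nat \<Rightarrow> (complex \<Rightarrow> complex) \<Rightarrow> bool" where
  "is_sigma p f \<longleftrightarrow>
     galois_aut f \<and>
     (\<forall>z. p'_root_of_unity p z \<longrightarrow> f z = z ^ p) \<and>
     (\<forall>z. p_root_of_unity p z \<longrightarrow> f z = z)"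


section \<open>The signs\<close>

text \<open>The divisions by 2 are exact in the respective cases \<open>bar_sgn L = -1\<close> and
  \<open>bar_sgn L = 1\<close> in which the two numbers are used.\<close>

definition a_val :: "nat set \<Rightarrow> complex" where
  "a_val L = of_real (sqrt 2) * \<i> ^ ((bar_size L - card L + 1) div 2)
              * of_real (sqrt (real (\<Prod>L)))"

definition b_val :: "nat set \<Rightarrow> complex" where
  "b_val L = \<i> ^ ((bar_size L - card L) div 2) * of_real (sqrt (real (\<Prod>L)))"

definition tau :: "nat set \<Rightarrow> (complex \<Rightarrow> complex) \<Rightarrow> int" where
  "tau L f =
     (THE s. s \<in> {-1, 1} \<and>
        (if bar_sgn L = -1 then f (a_val L) = of_int s * a_val L
         else f (b_val L) = of_int s * b_val L))"

end

theory Submission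
  imports "HOL-Number_Theory.Quadratic_Reciprocity" Defs
begin

text \<open>
  A Galois automorphism multiplies \<open>\<i>\<close> and every \<open>\<surd>n\<close> by a sign, and these signs determine \<open>\<tau>\<close>. For \<open>\<sigma>\<close>,
  quadratic Gauss sums and quadratic reciprocity show that the sign of \<open>\<surd>n\<close> is the Legendre symbol
  \<open>(n/p)\<close> when \<open>p\<close> does not divide \<open>n\<close>, and that the sign of \<open>\<i>\<close> is \<open>(-1/p)\<close>; for an automorphism fixing the
  \<open>p'\<close>-roots of unity both signs are 1. In either case the sign \<open>u\<close> of \<open>\<i>\<close> relates the residues \<open>r\<close> and \<open>p - r\<close>,
  and the sign of a part not divisible by \<open>p\<close> depends only on its residue, so it can be read off the runners.
  The parts divisible by \<open>p\<close> are the same for \<open>\<lambda>\<close> and its cocore.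

  If \<open>D\<close> counts the parts whose residue exceeds \<open>p/2\<close>, then both \<open>(|\<lambda>| - \<ell>(\<lambda>))/2 + D(\<lambda>)\<close> and the sign of
  \<open>\<Prod>\<lambda>\<close> times \<open>u ^ D(\<lambda>)\<close> are compatible with the decomposition into core and cocore, so the powers of \<open>u\<close>
  cancel. Only rounding is left: if the core and the cocore both have sign \<open>-1\<close>, the two halved exponents
  contribute one extra factor \<open>u\<close>.
\<close>

section \<open>Sums and products of algebraic numbers\<close>

text \<open>With the field viewed as a rational vector space, algebraic numbers are those whose
  powers lie in a finitely generated subspace, a condition that passes to sums and products.\<close>

interpretation rat_span: vector_space "\<lambda>(q::rat) (x::'a::field_char_0). of_rat q * x"
  by unfold_locales (simp_all add: algebra_simps of_rat_add of_rat_mult)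

text \<open>More than \<open>card T\<close> vectors in the span of \<open>T\<close> are dependent,
  and a rational dependency among powers of \<open>z\<close> is a polynomial with root
  \<open>z\<close>.\<close>

lemma algebraic_if_powers_in_finite_span:
  fixes z :: "'a::field_char_0"
  assumes "finite T" and powers: "\<And>k. z ^ k \<in> rat_span.span T"
  shows "algebraic z"
proof (cases "inj_on (\<lambda>k. z ^ k) {..card T}")
  \<comment> \<open>Dependence concerns the set of powers. If two of them coincide, that set may be
    too small, and \<open>X^j - X^i\<close> serves instead.\<close>
  case False
  then obtain i j where ij: "i < j" "z ^ i = z ^ j"
    unfolding inj_on_def by (metis linorder_neqE_nat)
  define h :: "'a poly" where "h = monom 1 j - monom 1 i"
  have "coeff h j = 1" using ij by (simp add: h_def)
  then have "h \<noteq> 0" by auto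
  moreover have "poly h z = 0" using ij by (simp add: h_def poly_monom)
  moreover have "coeff h k \<in> \<int>" for k by (simp add: h_def)
  ultimately show ?thesis by (intro algebraicI)
next
  case inj: True
  let ?P = "(\<lambda>k. z ^ k) ` {..card T}"
  have "card ?P = Suc (card T)" using inj by (simp add: card_image)
  then have "rat_span.dependent ?P"
    using rat_span.independent_span_bound[OF \<open>finite T\<close>, of ?P] powers by auto
  then obtain u v where u: "(\<Sum>w\<in>?P. of_rat (u w) * w) = 0" "v \<in> ?P" "u v \<noteq> 0"
    unfolding rat_span.dependent_finite[OF finite_imageI[OF finite_atMost]] by auto
  obtain j where j: "j \<le> card T" "v = z ^ j" using u(2) by auto
  define h :: "'a poly" where "h = (\<Sum>k\<le>card T. monom (of_rat (u (z ^ k))) k)"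
  have coeff_h: "coeff h k = (if k \<le> card T then of_rat (u (z ^ k)) else 0)" for k
    by (simp add: h_def coeff_sum if_distrib sum.delta cong: if_cong)
  then have "coeff h j \<noteq> 0" using j u(3) by simp
  then have "h \<noteq> 0" by auto
  moreover have "poly h z = 0"
    using u(1) inj by (simp add: h_def poly_sum poly_monom sum.reindex)
  moreover have "coeff h k \<in> \<rat>" for k by (simp add: coeff_h)
  ultimately show ?thesis by (intro algebraicI')
qed

text \<open>Dividing by the leading coefficient expresses \<open>x ^ n\<close>, and then by
  induction every higher power, through the powers below the degree.\<close>

lemma algebraic_powers_in_finite_span:
  fixes x :: "'a::field_char_0"
  assumes "algebraic x"
  obtains T where "finite T" "\<And>k. x ^ k \<in> rat_span.span T"
proof -
  obtain h where h: "\<And>i. coeff h i \<in> \<rat>" "h \<noteq> 0" "poly h x = 0"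
    using assms by (elim algebraicE) (metis Ints_subset_Rats subsetD)
  define n where "n = degree h"
  define T where "T = (\<lambda>k. x ^ k) ` {..<n}"
  have "\<forall>i. \<exists>q. coeff h i = of_rat q" using h(1) Rats_cases by metis
  then obtain c where c: "\<And>i. coeff h i = of_rat (c i)" by metis
  have lead: "c n \<noteq> 0" using h(2) c[of n] by (auto simp: n_def)
  have "0 = (\<Sum>i<n. of_rat (c i) * x ^ i) + of_rat (c n) * x ^ n"
    using h(3) c by (simp add: poly_altdef n_def lessThan_Suc_atMost[symmetric])
  then have "of_rat (c n) * x ^ n = - (\<Sum>i<n. of_rat (c i) * x ^ i)"
    by (metis add.commute eq_neg_iff_add_eq_0)
  then have xn: "x ^ n = (\<Sum>i<n. of_rat (- c i / c n) * x ^ i)"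
    proof -
    have "x ^ n = (\<Sum>i<n. - (of_rat (c i) * x ^ i)) / of_rat (c n)"
      by (metis \<open>of_rat (c n) * x ^ n = _\<close> lead nonzero_mult_div_cancel_left of_rat_eq_0_iff sum_negf)
    then show ?thesis by (simp add: of_rat_divide of_rat_minus sum_divide_distrib)
  qed
  have "x ^ k \<in> rat_span.span T" for k
  proof (induction k rule: less_induct)
    case (less k)
    show ?case
    proof (cases "k < n")
      case True then show ?thesis by (auto simp: T_def intro: rat_span.span_base)
    next
      case False
      then have "x ^ k = x ^ n * x ^ (k - n)" by (simp flip: power_add)
      also have "\<dots> = (\<Sum>i<n. of_rat (- c i / c n) * x ^ (i + (k - n)))"
        by (simp add: xn sum_distrib_right power_add mult.assoc)
      also have "\<dots> \<in> rat_span.span T"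
        using False by (intro rat_span.span_sum rat_span.span_scale less.IH) auto
      finally show ?thesis .
    qed
  qed
  moreover have "finite T" by (simp add: T_def)
  ultimately show ?thesis using that by blast
qed

lemma rat_span_times:
  fixes x y :: "'a::field_char_0"
  assumes "x \<in> rat_span.span S" "y \<in> rat_span.span T"
  shows "x * y \<in> rat_span.span ((\<lambda>(a, b). a * b) ` (S \<times> T))"
  using assms(1)
proof (induction rule: rat_span.span_induct_alt)
  case base show ?case by (simp add: rat_span.span_zero)
next
  case (step c a z)
  have "a * y \<in> rat_span.span ((\<lambda>(a, b). a * b) ` (S \<times> T))"
    using assms(2)
  proof (induction rule: rat_span.span_induct_alt)
    case base show ?case by (simp add: rat_span.span_zero)
  next
    case (step d b w)
    have "a * b \<in> rat_span.span ((\<lambda>(a, b). a * b) ` (S \<times> T))"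
      using \<open>a \<in> S\<close> \<open>b \<in> T\<close> by (intro rat_span.span_base) auto
    then have "of_rat d * (a * b) + a * w \<in> rat_span.span ((\<lambda>(a, b). a * b) ` (S \<times> T))"
      using step by (intro rat_span.span_add rat_span.span_scale) auto
    then show ?case by (simp add: algebra_simps)
  qed
  then have "of_rat c * (a * y) + z * y \<in> rat_span.span ((\<lambda>(a, b). a * b) ` (S \<times> T))"
    using step by (intro rat_span.span_add rat_span.span_scale) auto
  then show ?case by (simp add: algebra_simps)
qed

text \<open>The finitely many products of spanning vectors span all \<open>x ^ i * y ^ j\<close>,
  hence the powers of \<open>x * y\<close> and, by the binomial theorem, those of
  \<open>x + y\<close>.\<close>

lemma algebraic_add_mult:
  fixes x y :: "'a::field_char_0"
  assumes "algebraic x" "algebraic y"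
  shows algebraic_add: "algebraic (x + y)" and algebraic_mult: "algebraic (x * y)"
proof -
  obtain S where S: "finite S" "\<And>k. x ^ k \<in> rat_span.span S"
    using algebraic_powers_in_finite_span[OF assms(1)] by metis
  obtain T where T: "finite T" "\<And>k. y ^ k \<in> rat_span.span T"
    using algebraic_powers_in_finite_span[OF assms(2)] by metis
  let ?W = "(\<lambda>(a, b). a * b) ` (S \<times> T)"
  have fin: "finite ?W" using S T by simp
  have prods: "x ^ i * y ^ j \<in> rat_span.span ?W" for i j
    by (rule rat_span_times[OF S(2) T(2)])
  show "algebraic (x * y)"
    by (rule algebraic_if_powers_in_finite_span[OF fin]) (simp add: power_mult_distrib prods)
  have "(x + y) ^ k \<in> rat_span.span ?W" for k
  proof -
    have "(x + y) ^ k = (\<Sum>i\<le>k. of_rat (of_nat (k choose i)) * (x ^ i * y ^ (k - i)))"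
      by (simp add: binomial_ring mult.assoc)
    also have "\<dots> \<in> rat_span.span ?W"
      by (intro rat_span.span_sum rat_span.span_scale prods)
    finally show ?thesis .
  qed
  then show "algebraic (x + y)"
    by (rule algebraic_if_powers_in_finite_span[OF fin])
qed

lemma algebraic_sum:
  "(\<And>i. i \<in> I \<Longrightarrow> algebraic (g i)) \<Longrightarrow> algebraic (\<Sum>i\<in>I. g i)"
  by (induction I rule: infinite_finite_induct) (auto intro: algebraic_add)

lemma algebraic_prod:
  "(\<And>i. i \<in> I \<Longrightarrow> algebraic (g i)) \<Longrightarrow> algebraic (\<Prod>i\<in>I. g i)"
  by (induction I rule: infinite_finite_induct) (auto intro: algebraic_mult)

lemma algebraic_power: "algebraic x \<Longrightarrow> algebraic (x ^ n)"
  by (induction n) (auto intro: algebraic_mult)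

lemma algebraic_root_of_unity:
  assumes "n > 0" "z ^ n = (1::'a::field_char_0)"
  shows "algebraic z"
proof (rule algebraic_root[where p = "monom 1 n" and y = 1])
  show "degree (monom (1::'a) n) > 0" using assms by (simp add: degree_monom_eq)
qed (use assms in \<open>auto simp: poly_monom degree_monom_eq coeff_monom\<close>)

section \<open>The signs of a Galois automorphism\<close>

lemma bar_sgn_eq_iff:
  "bar_sgn L = - 1 \<longleftrightarrow> odd (bar_size L - card L)"
  "bar_sgn L = 1 \<longleftrightarrow> even (bar_size L - card L)"
  by (auto simp: bar_sgn_def minus_one_power_iff)

locale galois_automorphism =
  fixes f :: "complex \<Rightarrow> complex"
  assumes galois: "galois_aut f"
begin

lemma add: "algebraic x \<Longrightarrow> algebraic y \<Longrightarrow> f (x + y) = f x + f y"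
  and mult: "algebraic x \<Longrightarrow> algebraic y \<Longrightarrow> f (x * y) = f x * f y"
  and rat: "q \<in> \<rat> \<Longrightarrow> f q = q"
  using galois by (auto simp: galois_aut_def Qbar_def)

lemma one [simp]: "f 1 = 1" and zero [simp]: "f 0 = 0" and of_int [simp]: "f (of_int k) = of_int k"
  by (auto intro: rat)

lemma power: "algebraic x \<Longrightarrow> f (x ^ n) = f x ^ n"
  by (induction n) (simp_all add: mult algebraic_power)

lemma sum: "(\<And>i. i \<in> I \<Longrightarrow> algebraic (g i)) \<Longrightarrow> f (\<Sum>i\<in>I. g i) = (\<Sum>i\<in>I. f (g i))"
  by (induction I rule: infinite_finite_induct) (auto simp: add algebraic_sum)

lemma prod: "(\<And>i. i \<in> I \<Longrightarrow> algebraic (g i)) \<Longrightarrow> f (\<Prod>i\<in>I. g i) = (\<Prod>i\<in>I. f (g i))"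
  by (induction I rule: infinite_finite_induct) (auto simp: mult algebraic_prod)

text \<open>\<open>f \<i>\<close> is a root of \<open>X^2 + 1\<close>, so the default -1 does mean
  \<open>f \<i> = - \<i>\<close>; \<open>sqrt_sign\<close> follows the same pattern with
  \<open>X^2 - n\<close>.\<close>

definition ii_sign :: int where
  "ii_sign = (if f \<i> = \<i> then 1 else - 1)"

definition sqrt_sign :: "nat \<Rightarrow> int" where
  "sqrt_sign n = (if f (of_real (sqrt n)) = of_real (sqrt n) then 1 else - 1)"

lemma ii_sign_cases: "ii_sign = 1 \<or> ii_sign = - 1"
  by (simp add: ii_sign_def)

lemma sqrt_sign_cases: "sqrt_sign n = 1 \<or> sqrt_sign n = - 1"
  by (simp add: sqrt_sign_def)

lemma f_ii: "f \<i> = of_int ii_sign * \<i>"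
proof -
  have "f \<i> ^ 2 = \<i> ^ 2"
    using power[of \<i> 2] rat[of "- 1"] by simp
  then show ?thesis
    unfolding power2_eq_iff by (auto simp: ii_sign_def)
qed

lemma algebraic_sqrt_nat: "algebraic (complex_of_real (sqrt (real n)))"
  by (intro algebraic_of_real algebraic_sqrt) simp

lemma f_sqrt: "f (of_real (sqrt n)) = of_int (sqrt_sign n) * of_real (sqrt n)"
proof -
  have "(of_real (sqrt n) :: complex) ^ 2 = of_nat n"
    by (simp flip: of_real_power)
  then have "f (of_real (sqrt n)) ^ 2 = of_real (sqrt n) ^ 2"
    using power[OF algebraic_sqrt_nat, of n 2] rat[of "of_nat n"] by simp
  then show ?thesis
    unfolding power2_eq_iff by (auto simp: sqrt_sign_def)
qed

lemma sqrt_sign_eqI: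
  assumes "f (of_real (sqrt n)) = of_int s * of_real (sqrt n)" "n > 0"
  shows "sqrt_sign n = s"
  using assms f_sqrt[of n] by simp

lemma sqrt_sign_mult:
  assumes "m > 0" "n > 0"
  shows "sqrt_sign (m * n) = sqrt_sign m * sqrt_sign n"
proof (rule sqrt_sign_eqI)
  show "f (of_real (sqrt (m * n))) = of_int (sqrt_sign m * sqrt_sign n) * of_real (sqrt (m * n))"
    using mult[OF algebraic_sqrt_nat algebraic_sqrt_nat, of m n]
    by (simp add: real_sqrt_mult f_sqrt)
qed (use assms in simp)

lemma sqrt_sign_1 [simp]: "sqrt_sign (Suc 0) = 1"
  by (rule sqrt_sign_eqI) auto

lemma sqrt_sign_prod:
  assumes "finite L" "0 \<notin> L"
  shows "sqrt_sign (\<Prod>L) = (\<Prod>l\<in>L. sqrt_sign l)"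
  using assms
proof (induction L)
  case (insert x F)
  then have "\<Prod>F > 0" by (intro prod_pos) (metis gr0I insertI2)
  with insert show ?case by (simp add: sqrt_sign_mult)
qed simp

text \<open>A nonzero \<open>x\<close> determines the sign, so the definite description in
  \<open>tau\<close> is met by any sign that works.\<close>

lemma tau_eqI:
  assumes "s \<in> {- 1, 1}" "x \<noteq> 0" "f x = of_int s * x"
    "x = (if bar_sgn L = - 1 then a_val L else b_val L)"
  shows "tau L f = s"
proof -
  have unique: "t = s" if "f x = of_int t * x" for t :: int
    using that assms(2,3) by simp
  show ?thesis
    unfolding tau_def
  proof (rule the_equality)
    show "s \<in> {- 1, 1} \<and> (if bar_sgn L = - 1 then f (a_val L) = of_int s * a_val L
        else f (b_val L) = of_int s * b_val L)"
      using assms(1,3,4) by (cases "bar_sgn L = - 1") simp_all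
    show "t = s" if "t \<in> {- 1, 1} \<and> (if bar_sgn L = - 1 then f (a_val L) = of_int t * a_val L
        else f (b_val L) = of_int t * b_val L)" for t
      using that assms(4) unique[of t] by (cases "bar_sgn L = - 1") simp_all
  qed
qed

text \<open>\<open>f\<close> acts on \<open>a_val\<close> and \<open>b_val\<close> factor by factor:
  on the root of 2, on the power of \<open>\<i>\<close> and on the root of the product of the
  parts.\<close>

lemma tau_eq:
  assumes "bar_partition L"
  defines "N \<equiv> bar_size L - card L"
  shows "tau L f = (if odd N then sqrt_sign 2 * ii_sign ^ ((N + 1) div 2) else ii_sign ^ (N div 2))
                    * (\<Prod>l\<in>L. sqrt_sign l)"
proof (rule tau_eqI)
  let ?x = "if bar_sgn L = - 1 then a_val L else b_val L"
  have L: "finite L" "0 \<notin> L" using assms by (auto simp: bar_partition_def)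
  have nz: "\<Prod>L > 0" using L by (intro prod_pos) (metis gr0I)
  show "?x \<noteq> 0" using nz by (auto simp: a_val_def b_val_def simp del: of_nat_prod)
  have sqrt_prod: "f (of_real (sqrt (real (\<Prod>L)))) = of_int (\<Prod>l\<in>L. sqrt_sign l) * of_real (sqrt (real (\<Prod>L)))"
    using f_sqrt[of "\<Prod>L"] sqrt_sign_prod[OF L] by simp
  have ii_power: "f (\<i> ^ k) = of_int (ii_sign ^ k) * \<i> ^ k" for k
    by (simp add: power f_ii power_mult_distrib)
  have alg: "algebraic (\<i> ^ k)" "algebraic (of_real (sqrt 2) * \<i> ^ k)" for k
    using algebraic_sqrt_nat[of 2] by (auto intro: algebraic_mult algebraic_power)
  have sqrt2_ii: "f (of_real (sqrt 2) * \<i> ^ k) = of_int (sqrt_sign 2 * ii_sign ^ k) * (of_real (sqrt 2) * \<i> ^ k)" for k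
    using mult[of "of_real (sqrt 2)" "\<i> ^ k"] algebraic_sqrt_nat[of 2] alg f_sqrt[of 2] ii_power[of k]
    by (simp add: mult_ac)
  have "f (a_val L) = of_int (sqrt_sign 2 * ii_sign ^ ((N + 1) div 2) * (\<Prod>l\<in>L. sqrt_sign l)) * a_val L"
    unfolding a_val_def N_def
    by (subst mult[OF alg(2) algebraic_sqrt_nat]) (simp only: sqrt_prod sqrt2_ii of_int_mult mult_ac)
  moreover have "f (b_val L) = of_int (ii_sign ^ (N div 2) * (\<Prod>l\<in>L. sqrt_sign l)) * b_val L"
    unfolding b_val_def N_def
    by (subst mult[OF alg(1) algebraic_sqrt_nat]) (simp only: sqrt_prod ii_power of_int_mult mult_ac)
  ultimately show "f ?x = of_int ((if odd N then sqrt_sign 2 * ii_sign ^ ((N + 1) div 2)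
        else ii_sign ^ (N div 2)) * (\<Prod>l\<in>L. sqrt_sign l)) * ?x"
    by (simp add: bar_sgn_eq_iff N_def)
  have prod_unit: "(\<Prod>l\<in>L. sqrt_sign l) \<in> {- 1, 1}"
    using \<open>finite L\<close>
  proof (induction L)
    case (insert l F)
    then show ?case using sqrt_sign_cases[of l] by auto
  qed simp
  have pow_unit: "ii_sign ^ k \<in> {- 1, 1}" for k
    using ii_sign_cases by (cases "even k") auto
  show "(if odd N then sqrt_sign 2 * ii_sign ^ ((N + 1) div 2) else ii_sign ^ (N div 2))
        * (\<Prod>l\<in>L. sqrt_sign l) \<in> {- 1, 1}"
    using prod_unit pow_unit[of "(N + 1) div 2"] pow_unit[of "N div 2"] sqrt_sign_cases[of 2]
    by (auto simp del: power_eq_1_iff)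
qed simp

end

section \<open>Values of the Legendre symbol\<close>

lemma unit_eq_if_cong:
  fixes a b :: int and q :: nat
  assumes "[a = b] (mod int q)" "q > 2" "a \<in> {- 1, 0, 1}" "b \<in> {- 1, 0, 1}"
  shows "a = b"
proof -
  have "int q dvd a - b" using assms(1) by (simp add: cong_iff_dvd_diff)
  \<comment> \<open>Two elements of {-1, 0, 1} differ by at most 2, which is less than
    \<open>q\<close>; this later turns Euler's congruence into equalities.\<close>
  moreover have "\<bar>a - b\<bar> < int q" using assms by auto
  ultimately show ?thesis using dvd_imp_le_int[of "a - b" "int q"] by auto
qed

lemma Legendre_values: "Legendre a q \<in> {- 1, 0, 1}"
  by (simp add: Legendre_def)

lemma Legendre_mult:
  fixes q :: nat
  assumes "prime q" "q > 2"
  shows "Legendre (a * b) q = Legendre a q * Legendre b q"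
proof (rule unit_eq_if_cong)
  have "[Legendre a q * Legendre b q = a ^ ((q - 1) div 2) * b ^ ((q - 1) div 2)] (mod q)"
    using assms by (intro cong_mult euler_criterion)
  then show "[Legendre (a * b) q = Legendre a q * Legendre b q] (mod q)"
    using euler_criterion[OF assms, of "a * b"] by (metis cong_sym cong_trans power_mult_distrib)
  show "Legendre a q * Legendre b q \<in> {- 1, 0, 1}"
    using Legendre_values[of a q] Legendre_values[of b q] by auto
qed (rule assms Legendre_values)+

lemma Legendre_cong: "[a = b] (mod q) \<Longrightarrow> Legendre a q = Legendre b q"
  by (simp add: Legendre_def QuadRes_def cong_def)

lemma Legendre_1:
  assumes "q > 2"
  shows "Legendre 1 q = 1"
proof -
  have "QuadRes q 1" unfolding QuadRes_def by (rule exI[of _ 1]) simp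
  moreover have "\<not> [1 = 0] (mod q)" using assms by (simp add: cong_0_iff)
  ultimately show ?thesis by (simp add: Legendre_def)
qed

lemma Legendre_minus_1:
  fixes q :: nat
  assumes "prime q" "q > 2"
  shows "Legendre (- 1) q = (- 1) ^ ((q - 1) div 2)"
  by (rule unit_eq_if_cong[OF euler_criterion[OF assms] assms(2) Legendre_values])
     (simp add: minus_one_power_iff)

lemma Legendre_eq_0_iff: "Legendre a q = 0 \<longleftrightarrow> q dvd a"
  by (simp add: Legendre_def cong_0_iff)

lemma Legendre_unit: "\<not> q dvd a \<Longrightarrow> Legendre a q = 1 \<or> Legendre a q = - 1"
  using Legendre_values[of a q] Legendre_eq_0_iff[of a q] by auto

text \<open>Gauss's lemma for 2: the exponent counts the \<open>x\<close> from 1 to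
  \<open>(p - 1) div 2\<close> for which \<open>2 * x\<close> exceeds half of
  \<open>p\<close>.\<close>

lemma Legendre_2:
  fixes p :: nat
  assumes "prime p" "p > 2"
  shows "Legendre 2 p = (- 1) ^ ((p - 1) div 2 - (p - 1) div 2 div 2)"
proof -
  have "odd p" using assms prime_odd_nat by blast
  interpret GAUSS p 2
    using assms \<open>odd p\<close> by unfold_locales (auto simp: cong_0_iff zdvd_not_zless)
  define h where "h = (p - 1) div 2"
  have p: "p = 2 * h + 1" using \<open>odd p\<close> by (auto simp: h_def elim: oddE)
  have half: "(int p - 1) div 2 = int h" using p by simp
  \<comment> \<open>All \<open>2 * x\<close> with \<open>x \<le> h\<close> stay below
    \<open>p\<close>, so no reduction takes place, and those above \<open>h\<close> are the ones
    with \<open>x > h div 2\<close>.\<close>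
  have "E = (\<lambda>x. 2 * int x) ` {h div 2<..h}"
  proof (rule Set.set_eqI)
    fix z
    have "z \<in> E \<longleftrightarrow> (\<exists>x. 0 < x \<and> x \<le> (int p - 1) div 2 \<and> z = (x * 2) mod int p
        \<and> z > (int p - 1) div 2)"
      by (auto simp: E_def C_def B_def A_def image_iff Bex_def)
    also have "\<dots> \<longleftrightarrow> (\<exists>x. 0 < x \<and> x \<le> int h \<and> z = 2 * x \<and> z > int h)"
      unfolding half using p by (intro ex_cong1) (auto simp: mod_pos_pos_trivial)
    also have "\<dots> \<longleftrightarrow> z \<in> (\<lambda>x. 2 * int x) ` {h div 2<..h}"
    proof
      assume "\<exists>x. 0 < x \<and> x \<le> int h \<and> z = 2 * x \<and> z > int h"
      then obtain x where "0 < x" "x \<le> int h" "z = 2 * x" "z > int h" by blast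
      then show "z \<in> (\<lambda>x. 2 * int x) ` {h div 2<..h}"
        by (intro image_eqI[of _ _ "nat x"]) auto
    qed auto
    finally show "z \<in> E \<longleftrightarrow> z \<in> (\<lambda>x. 2 * int x) ` {h div 2<..h}" .
  qed
  then have "card E = h - h div 2" by (simp add: card_image inj_on_def)
  then show ?thesis using gauss_lemma by (simp add: h_def)
qed

section \<open>Quadratic Gauss sums\<close>

text \<open>For \<open>q > 0\<close> this is the power with integer exponent \<open>a\<close> of a
  fixed primitive \<open>q\<close>-th root of unity; for \<open>q = 0\<close> it is 1 by division by
  zero.\<close>

definition unit_root :: "nat \<Rightarrow> int \<Rightarrow> complex" where
  "unit_root q a = cis (2 * pi * of_int a / of_nat q)"

lemma unit_root_add: "unit_root q (a + b) = unit_root q a * unit_root q b"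
  by (simp add: unit_root_def cis_mult ring_distribs add_divide_distrib)

lemma unit_root_0 [simp]: "unit_root q 0 = 1"
  by (simp add: unit_root_def)

lemma unit_root_power: "unit_root q a ^ n = unit_root q (a * int n)"
  by (simp add: unit_root_def DeMoivre mult_ac)

lemma unit_root_multiple: "unit_root q (int q * a) = 1"
  using cis_multiple_2pi[of "of_int a"] by (cases "q = 0") (simp_all add: unit_root_def mult.assoc)

lemma unit_root_cong:
  assumes "[a = b] (mod int q)"
  shows "unit_root q a = unit_root q b"
proof -
  obtain k where "a = b + int q * k" using assms by (metis cong_iff_lin cong_sym)
  then show ?thesis by (simp add: unit_root_add unit_root_multiple)
qed

lemma unit_root_mod: "unit_root q (a mod int q) = unit_root q a"
  by (intro unit_root_cong) simp

lemma unit_root_power_order: "unit_root q a ^ q = 1"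
  using unit_root_multiple[of q a] by (simp add: unit_root_power mult.commute)

lemma unit_root_eq_1_iff:
  assumes "q > 0"
  shows "unit_root q a = 1 \<longleftrightarrow> int q dvd a"
proof
  assume "unit_root q a = 1"
  then obtain k :: int where "2 * pi * of_int a / of_nat q = 2 * pi * of_int k"
    by (auto simp: unit_root_def complex_eq_iff cos_one_2pi_int)
  then have "real_of_int a = real_of_int (int q * k)" using assms by (simp add: field_simps)
  then show "int q dvd a" unfolding of_int_eq_iff by simp
next
  assume "int q dvd a"
  then show "unit_root q a = 1" using unit_root_multiple by (metis dvdE)
qed

lemma algebraic_unit_root: "q > 0 \<Longrightarrow> algebraic (unit_root q a)"
  using algebraic_root_of_unity[OF _ unit_root_power_order] by blast

lemma sum_unit_root:
  assumes "q > 0"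
  shows "(\<Sum>a\<in>{0..<int q}. unit_root q (a * c)) = (if int q dvd c then of_nat q else 0)"
proof -
  have "(\<Sum>a\<in>{0..<int q}. unit_root q (a * c)) = (\<Sum>n<q. unit_root q c ^ n)"
    by (rule sum.reindex_bij_witness[of _ int nat]) (auto simp: unit_root_power mult.commute)
  also have "\<dots> = (if int q dvd c then of_nat q else 0)"
    using unit_root_eq_1_iff[OF assms, of c]
    by (auto simp: geometric_sum unit_root_power_order)
  finally show ?thesis .
qed

lemma sum_residues_mult:
  fixes g :: "int \<Rightarrow> 'a::comm_monoid_add"
  assumes "coprime c (int q)" "q > 0" and periodic: "\<And>a. g (a mod int q) = g a"
  shows "(\<Sum>a\<in>{0..<int q}. g (c * a)) = (\<Sum>a\<in>{0..<int q}. g a)"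
proof -
  have inj: "inj_on (\<lambda>a. c * a mod int q) {0..<int q}"
  proof (rule inj_onI)
    fix a b assume ab: "a \<in> {0..<int q}" "b \<in> {0..<int q}" "c * a mod int q = c * b mod int q"
    then have "[a = b] (mod int q)"
      using cong_mult_lcancel[OF assms(1)] by (simp add: cong_def)
    then show "a = b" using ab by (simp add: cong_def)
  qed
  have "(\<lambda>a. c * a mod int q) ` {0..<int q} = {0..<int q}"
    using \<open>q > 0\<close> by (intro endo_inj_surj inj) auto
  then have "(\<Sum>a\<in>{0..<int q}. g a) = (\<Sum>a\<in>{0..<int q}. g (c * a mod int q))"
    using sum.reindex[OF inj, of g] by simp
  then show ?thesis by (simp add: periodic)
qed

definition gauss_sum :: "nat \<Rightarrow> int \<Rightarrow> complex" where
  "gauss_sum q k = (\<Sum>a\<in>{0..<int q}. of_int (Legendre a q) * unit_root q (k * a))"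

lemma Legendre_mod: "Legendre (a mod int q) (int q) = Legendre a (int q)"
  by (intro Legendre_cong) simp

lemma Legendre_square:
  assumes "prime q" "q > 2" "\<not> int q dvd a"
  shows "Legendre a q * Legendre a q = 1"
  using Legendre_unit[OF assms(3)] by auto

text \<open>The symbol of \<open>k\<close> squares to 1, so its square may be inserted; one factor
  makes the summand a function of \<open>k * a\<close>, and multiplication by \<open>k\<close>
  permutes the residues.\<close>

lemma gauss_sum_coprime:
  assumes "prime q" "q > 2" "\<not> int q dvd k"
  shows "gauss_sum q k = of_int (Legendre k q) * gauss_sum q 1"
proof -
  have "coprime k (int q)"
    using assms(1,3) by (metis coprime_commute prime_imp_coprime prime_nat_int_transfer)
  have "gauss_sum q k = of_int (Legendre k q) *
      (\<Sum>a\<in>{0..<int q}. of_int (Legendre (k * a) q) * unit_root q (k * a))"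
    using Legendre_square[OF assms]
    by (simp add: gauss_sum_def sum_distrib_left Legendre_mult[OF assms(1,2)] flip: mult.assoc of_int_mult)
  also have "(\<Sum>a\<in>{0..<int q}. of_int (Legendre (k * a) q) * unit_root q (k * a)) = gauss_sum q 1"
    unfolding gauss_sum_def
    using sum_residues_mult[OF \<open>coprime k (int q)\<close>, of "\<lambda>a. complex_of_int (Legendre a q) * unit_root q a"] assms
    by (simp add: Legendre_mod unit_root_mod)
  finally show ?thesis .
qed

text \<open>Squaring modulo \<open>q\<close> identifies 1 and -1, so it is not injective on the
  residues and hence not surjective.\<close>

lemma exists_nonresidue:
  fixes q :: nat
  assumes "prime q" "q > 2"
  obtains n where "Legendre n q = - 1"
proof -
  have "\<not> inj_on (\<lambda>a. a\<^sup>2 mod int q) {0..<int q}"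
  proof
    assume "inj_on (\<lambda>a. a\<^sup>2 mod int q) {0..<int q}"
    moreover have "1\<^sup>2 mod int q = (int q - 1)\<^sup>2 mod int q"
    proof -
      have "(int q - 1)\<^sup>2 = 1\<^sup>2 + int q * (int q - 2)"
        by (simp add: power2_eq_square algebra_simps)
      then show ?thesis by simp
    qed
    ultimately have "1 = int q - 1" using assms by (elim inj_onD) auto
    then show False using assms by simp
  qed
  then have "(\<lambda>a. a\<^sup>2 mod int q) ` {0..<int q} \<noteq> {0..<int q}"
    using finite_surj_inj[of "{0..<int q}" "\<lambda>a. a\<^sup>2 mod int q"] by auto
  moreover have "(\<lambda>a. a\<^sup>2 mod int q) ` {0..<int q} \<subseteq> {0..<int q}"
    using assms by auto
  ultimately obtain n where n: "n \<in> {0..<int q}" "n \<notin> (\<lambda>a. a\<^sup>2 mod int q) ` {0..<int q}"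
    by blast
  have "\<not> QuadRes q n"
  proof
    assume "QuadRes q n"
    then obtain y where "[y\<^sup>2 = n] (mod int q)" by (auto simp: QuadRes_def)
    then have "(y mod int q)\<^sup>2 mod int q = n" using n(1) by (simp add: cong_def power_mod)
    then show False using n(2) assms by (metis (no_types) atLeastLessThan_iff image_eqI
        of_nat_0_less_iff pos_mod_bound pos_mod_sign prime_gt_0_nat)
  qed
  moreover have "n \<noteq> 0"
    using n(2) assms by (metis (no_types, lifting) image_eqI mod_0 n(1) power2_eq_square mult_zero_left)
  ultimately have "Legendre n q = - 1"
    using n(1) by (auto simp: Legendre_def cong_0_iff zdvd_not_zless)
  then show ?thesis using that by blast
qed

text \<open>Multiplying the summation index by a nonresidue reverses the sign of the sum.\<close>

lemma gauss_sum_0: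
  assumes "prime q" "q > 2"
  shows "gauss_sum q 0 = 0"
proof -
  obtain n where n: "Legendre n q = - 1" using exists_nonresidue[OF assms] .
  then have "\<not> int q dvd n" by (metis Legendre_eq_0_iff zero_neq_neg_one)
  then have "coprime n (int q)"
    using assms(1) by (metis coprime_commute prime_imp_coprime prime_nat_int_transfer)
  then have "gauss_sum q 0 = (\<Sum>a\<in>{0..<int q}. of_int (Legendre (n * a) q))"
    using sum_residues_mult[of n q "\<lambda>a. complex_of_int (Legendre a q)"] assms
    by (simp add: gauss_sum_def Legendre_mod)
  also have "\<dots> = - gauss_sum q 0"
    using n by (simp add: gauss_sum_def Legendre_mult[OF assms] sum_negf)
  finally show ?thesis by simp
qed

text \<open>The Legendre factor of one sum is absorbed into the other; after exchanging the
  summations, orthogonality of the roots of unity retains only the index congruent to -1.\<close>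

lemma gauss_sum_square:
  assumes "prime q" "q > 2"
  shows "gauss_sum q 1 ^ 2 = (- 1) ^ ((q - 1) div 2) * of_nat q"
proof -
  \<comment> \<open>For \<open>q\<close> dividing \<open>a\<close> both sides vanish, the right one
    by \<open>gauss_sum_0\<close>.\<close>
  have shift: "of_int (Legendre a q) * gauss_sum q 1 = gauss_sum q a" for a
    using gauss_sum_coprime[OF assms, of a] gauss_sum_0[OF assms] Legendre_eq_0_iff[of a q]
    by (cases "int q dvd a") (auto simp: gauss_sum_def unit_root_multiple mult.assoc elim!: dvdE)
  have dvd_iff: "int q dvd 1 + b \<longleftrightarrow> b = int q - 1" if "b \<in> {0..<int q}" for b
  proof
    assume "int q dvd 1 + b"
    then have "int q \<le> 1 + b" using that by (intro zdvd_imp_le) auto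
    then show "b = int q - 1" using that by simp
  qed simp
  have expand: "gauss_sum q 1 * G = (\<Sum>a\<in>{0..<int q}. unit_root q a * (of_int (Legendre a q) * G))" for G
    by (simp add: gauss_sum_def sum_distrib_left mult_ac)
  have "gauss_sum q 1 ^ 2 = (\<Sum>a\<in>{0..<int q}. unit_root q a * gauss_sum q a)"
    unfolding power2_eq_square expand shift ..
  also have "\<dots> = (\<Sum>a\<in>{0..<int q}. \<Sum>b\<in>{0..<int q}.
      of_int (Legendre b q) * unit_root q (a * (1 + b)))"
    by (simp add: gauss_sum_def sum_distrib_left ring_distribs unit_root_add mult_ac)
  also have "\<dots> = (\<Sum>b\<in>{0..<int q}. of_int (Legendre b q) * (\<Sum>a\<in>{0..<int q}. unit_root q (a * (1 + b))))"
    by (subst sum.swap) (simp add: sum_distrib_left)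
  also have "\<dots> = (\<Sum>b\<in>{0..<int q}. if b = int q - 1 then of_int (Legendre b q) * of_nat q else 0)"
    using assms by (intro sum.cong refl) (simp add: sum_unit_root dvd_iff)
  also have "\<dots> = of_int (Legendre (int q - 1) q) * of_nat q"
    using assms by (simp add: sum.delta)
  also have "Legendre (int q - 1) q = Legendre (- 1) q"
    by (rule Legendre_cong) (simp add: cong_def)
  finally show ?thesis using Legendre_minus_1[OF assms] by simp
qed

context galois_automorphism
begin

text \<open>Up to a sign the Gauss sum is \<open>\<i> ^ h\<close> times the root of
  \<open>q\<close>. Applying \<open>f\<close> to both expressions relates the symbol of
  \<open>k\<close> to the signs of \<open>\<i>\<close> and of that root.\<close>

lemma sqrt_sign_odd_prime:
  assumes "prime q" "q > 2" and k: "\<not> int q dvd k" and f: "f (unit_root q 1) = unit_root q k"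
  shows "sqrt_sign q = Legendre k q * ii_sign ^ ((q - 1) div 2)"
proof -
  define h where "h = (q - 1) div 2"
  have "q > 0" using assms by simp
  have f_unit_root: "f (unit_root q a) = unit_root q (k * a)" if "a \<ge> 0" for a
  proof -
    have "unit_root q a = unit_root q 1 ^ nat a" using that by (simp add: unit_root_power)
    then show ?thesis
      using that power[OF algebraic_unit_root[OF \<open>q > 0\<close>], of 1 "nat a"] f by (simp add: unit_root_power)
  qed
  have "f (gauss_sum q 1) = (\<Sum>a\<in>{0..<int q}. f (of_int (Legendre a q) * unit_root q (1 * a)))"
    unfolding gauss_sum_def
    by (rule sum) (rule algebraic_mult[OF algebraic_of_int algebraic_unit_root[OF \<open>q > 0\<close>]])
  also have "\<dots> = (\<Sum>a\<in>{0..<int q}. of_int (Legendre a q) * unit_root q (k * a))"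
  proof (rule sum.cong)
    fix a assume "a \<in> {0..<int q}"
    then show "f (of_int (Legendre a q) * unit_root q (1 * a)) = of_int (Legendre a q) * unit_root q (k * a)"
      using mult[OF algebraic_of_int algebraic_unit_root[OF \<open>q > 0\<close>], of "Legendre a q" a]
      by (simp add: f_unit_root)
  qed simp
  finally have "f (gauss_sum q 1) = gauss_sum q k"
    by (simp add: gauss_sum_def)
  then have f_gauss: "f (gauss_sum q 1) = of_int (Legendre k q) * gauss_sum q 1"
    using gauss_sum_coprime[OF assms(1-3)] by simp
  have "(of_real (sqrt q) :: complex) ^ 2 = of_nat q"
    by (simp flip: of_real_power)
  moreover have "(\<i> ^ h) ^ 2 = (- 1) ^ h"
    by (metis i_squared mult.commute power2_eq_square power_mult)
  ultimately have "gauss_sum q 1 ^ 2 = (\<i> ^ h * of_real (sqrt q)) ^ 2"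
    using gauss_sum_square[OF assms(1,2)] by (simp add: power_mult_distrib h_def)
  \<comment> \<open>The sign of the Gauss sum is left open: \<open>f\<close> fixes it, and it
    cancels.\<close>
  then obtain \<delta> :: int where \<delta>: "\<delta> = 1 \<or> \<delta> = - 1" "gauss_sum q 1 = of_int \<delta> * (\<i> ^ h * of_real (sqrt q))"
    unfolding power2_eq_iff by (metis mult_1 mult_minus1 of_int_1 of_int_minus)
  have "f (\<i> ^ h * of_real (sqrt q)) = of_int (ii_sign ^ h) * \<i> ^ h * f (of_real (sqrt q))"
    using algebraic_sqrt_nat[of q] by (simp add: mult power algebraic_power f_ii power_mult_distrib)
  then have "f (gauss_sum q 1) = of_int \<delta> * (of_int (ii_sign ^ h) * \<i> ^ h * f (of_real (sqrt q)))"
    using \<delta>(2) mult[of "of_int \<delta>" "\<i> ^ h * of_real (sqrt q)"] algebraic_sqrt_nat[of q]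
    by (simp add: algebraic_mult algebraic_power)
  then have "of_int (ii_sign ^ h) * f (of_real (sqrt q)) = of_int (Legendre k q) * of_real (sqrt q)"
    using f_gauss \<delta> by auto
  moreover have "ii_sign ^ h * ii_sign ^ h = 1"
    using ii_sign_cases by (metis mult_minus1_right minus_one_mult_self mult_1 power_one)
  then have "of_int (ii_sign ^ h) * (of_int (ii_sign ^ h) * f (of_real (sqrt q))) = f (of_real (sqrt q))"
    by (metis mult.assoc mult_1 of_int_1 of_int_mult)
  ultimately have "f (of_real (sqrt q)) = of_int (Legendre k q * ii_sign ^ h) * of_real (sqrt q)"
    by (simp add: mult_ac)
  then show ?thesis using \<open>q > 0\<close> unfolding h_def by (rule sqrt_sign_eqI)
qed

end

section \<open>Signs of square roots: the prime 2 and general integers\<close>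

lemma unit_root_8_4: "unit_root 8 4 = - 1"
  by (simp add: unit_root_def)

lemma sqrt_2_eq_unit_roots: "of_real (sqrt 2) = unit_root 8 1 + unit_root 8 7"
proof -
  have "unit_root 8 7 = unit_root 8 (- 1)"
    by (intro unit_root_cong) (simp add: cong_def)
  then show ?thesis
    by (simp add: unit_root_def complex_eq_iff cos_45 sin_45)
qed

text \<open>The second supplement to quadratic reciprocity: the residue of \<open>p\<close> modulo 8
  decides the parity of the exponent from Gauss's lemma.\<close>

lemma Legendre_2_eq:
  fixes p :: nat
  assumes "prime p" "p > 2"
  shows "Legendre 2 p = (if p mod 8 \<in> {1, 7} then 1 else - 1)"
proof -
  have "odd p" using assms prime_odd_nat by blast
  define m where "m = p div 8"
  have p: "p = 8 * m + p mod 8" by (simp add: m_def)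
  have "p mod 8 = 1 \<or> p mod 8 = 3 \<or> p mod 8 = 5 \<or> p mod 8 = 7"
    using \<open>odd p\<close> by presburger
  then consider "p = 8 * m + 1" "p mod 8 = 1" | "p = 8 * m + 3" "p mod 8 = 3"
    | "p = 8 * m + 5" "p mod 8 = 5" | "p = 8 * m + 7" "p mod 8 = 7"
    using p by fastforce
  then show ?thesis
  proof cases
    case 1
    have "(p - 1) div 2 - (p - 1) div 2 div 2 = 2 * m" by (simp add: 1(1))
    then show ?thesis using Legendre_2[OF assms] 1(2) by simp
  next
    case 2
    have "(p - 1) div 2 = 4 * m + 1" using 2(1) by simp
    then have "(p - 1) div 2 - (p - 1) div 2 div 2 = 2 * m + 1" by simp
    then show ?thesis using Legendre_2[OF assms] 2(2) by simp
  next
    case 3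
    have "(p - 1) div 2 = 4 * m + 2" using 3(1) by simp
    then have "(p - 1) div 2 - (p - 1) div 2 div 2 = 2 * m + 1" by simp
    then show ?thesis using Legendre_2[OF assms] 3(2) by simp
  next
    case 4
    have "(p - 1) div 2 = 4 * m + 3" using 4(1) by simp
    then have "(p - 1) div 2 - (p - 1) div 2 div 2 = 2 * (m + 1)" by simp
    then show ?thesis using Legendre_2[OF assms] 4(2) by (simp del: power_Suc)
  qed
qed

lemma p'_root_of_unity_unit_root: "n > 0 \<Longrightarrow> coprime n p \<Longrightarrow> p'_root_of_unity p (unit_root n a)"
  unfolding p'_root_of_unity_def using unit_root_power_order by blast

lemma coprime_power_of_2:
  fixes p :: nat
  assumes "odd p"
  shows "coprime 4 p" "coprime 8 p"
proof -
  have "coprime (2 ^ n) p" for n using assms by simp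
  from this[of 2] this[of 3] show "coprime 4 p" "coprime 8 p" by simp_all
qed

lemma p'_root_of_unity_ii: "odd p \<Longrightarrow> p'_root_of_unity p \<i>"
  unfolding p'_root_of_unity_def by (rule exI[of _ 4]) (simp add: coprime_power_of_2)

context galois_automorphism
begin

text \<open>The root of 2 is the sum of a primitive eighth root of unity and its inverse. Exponents
  1 and 7 permute the two summands; 3 and 5 negate the sum, because the fourth power is -1.\<close>

lemma sqrt_sign_2:
  assumes "f (unit_root 8 1) = unit_root 8 k" "odd k"
  shows "sqrt_sign 2 = (if k mod 8 \<in> {1, 7} then 1 else - 1)"
proof (rule sqrt_sign_eqI)
  have "f (unit_root 8 7) = f (unit_root 8 1 ^ 7)" by (simp add: unit_root_power)
  also have "\<dots> = unit_root 8 (7 * k)"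
    using power[OF algebraic_unit_root, of 8 1 7] assms(1) by (simp add: unit_root_power mult.commute)
  finally have "f (of_real (sqrt 2)) = unit_root 8 k + unit_root 8 (7 * k)"
    unfolding sqrt_2_eq_unit_roots using add[OF algebraic_unit_root algebraic_unit_root] assms(1) by simp
  also have "\<dots> = unit_root 8 (k mod 8) + unit_root 8 (7 * k mod 8)"
    using unit_root_mod[of 8 k] unit_root_mod[of 8 "7 * k"] by simp
  also have "\<dots> = of_int (if k mod 8 \<in> {1, 7} then 1 else - 1) * of_real (sqrt 2)"
  proof -
    have minus: "unit_root 8 3 = - unit_root 8 7" "unit_root 8 5 = - unit_root 8 1"
      using unit_root_add[of 8 3 4] unit_root_add[of 8 1 4] by (simp_all add: unit_root_8_4)
    have "k mod 8 = 1 \<or> k mod 8 = 3 \<or> k mod 8 = 5 \<or> k mod 8 = 7"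
      using \<open>odd k\<close> by presburger
    moreover have "7 * k mod 8 = 7 * (k mod 8) mod 8"
      by (simp add: mod_mult_right_eq)
    ultimately show ?thesis
      by (elim disjE) (simp_all add: sqrt_2_eq_unit_roots minus)
  qed
  finally show "f (of_real (sqrt (real 2))) = of_int (if k mod 8 \<in> {1, 7} then 1 else - 1) * of_real (sqrt (real 2))"
    by simp
qed simp

text \<open>Both sides are multiplicative, so agreement at the primes other than \<open>p\<close>
  propagates by splitting off prime factors.\<close>

lemma sqrt_sign_eq_multiplicative:
  fixes \<chi> :: "nat \<Rightarrow> int"
  assumes "\<chi> 1 = 1" "\<And>m n. \<chi> (m * n) = \<chi> m * \<chi> n"
    and "\<And>q. prime q \<Longrightarrow> q \<noteq> p \<Longrightarrow> sqrt_sign q = \<chi> q" and "l > 0" "\<not> p dvd l"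
  shows "sqrt_sign l = \<chi> l"
  using assms(4,5)
proof (induction l rule: less_induct)
  case (less l)
  show ?case
  proof (cases "l = 1")
    case True
    then show ?thesis using assms(1) by simp
  next
    case False
    then obtain q m where q: "prime q" "l = q * m"
      using prime_factor_nat[of l] by (metis dvdE)
    then have "m > 0" "m < l" "q \<noteq> p" "\<not> p dvd m"
      using less.prems prime_gt_1_nat[of q] by auto
    then have "sqrt_sign l = sqrt_sign q * sqrt_sign m"
      using q sqrt_sign_mult prime_gt_0_nat by simp
    also have "\<dots> = \<chi> l"
      using less.IH[of m] assms(2,3) q \<open>m > 0\<close> \<open>m < l\<close> \<open>q \<noteq> p\<close> \<open>\<not> p dvd m\<close> by simp
    finally show ?thesis .
  qed
qed

text \<open>The roots of unity involved have order 4, 8 or a prime \<open>q \<noteq> p\<close>, all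
  prime to \<open>p\<close>, so the exponent \<open>k\<close> is 1 throughout.\<close>

lemma sqrt_sign_if_trivial:
  assumes "prime p" "odd p" "\<And>z. p'_root_of_unity p z \<Longrightarrow> f z = z" "l > 0" "\<not> p dvd l"
  shows "sqrt_sign l = 1"
proof (rule sqrt_sign_eq_multiplicative[of "\<lambda>_. 1"])
  fix q :: nat assume q: "prime q" "q \<noteq> p"
  show "sqrt_sign q = 1"
  proof (cases "q = 2")
    case True
    show ?thesis
      using coprime_power_of_2[OF \<open>odd p\<close>] assms(3) p'_root_of_unity_unit_root[of 8 p 1] sqrt_sign_2[of 1] True by simp
  next
    case False
    then have "q > 2" using q prime_ge_2_nat[of q] by simp
    moreover have "f (unit_root q 1) = unit_root q 1"
      using q assms(1,3) prime_gt_0_nat[of q] by (intro assms(3) p'_root_of_unity_unit_root primes_coprime)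
    moreover have "ii_sign = 1"
      using assms(3)[OF p'_root_of_unity_ii[OF \<open>odd p\<close>]] by (simp add: ii_sign_def)
    ultimately show ?thesis
      using sqrt_sign_odd_prime[of q 1] Legendre_1[of "int q"] q by simp
  qed
qed (use assms in simp_all)

text \<open>The order 4 of \<open>\<i>\<close> is prime to \<open>p\<close>, so \<open>f\<close>
  raises it to the \<open>p\<close>-th power.\<close>

lemma sigma_ii_sign:
  assumes "is_sigma p f" "odd p"
  shows "ii_sign = (- 1) ^ ((p - 1) div 2)"
proof -
  obtain h where h: "p = 2 * h + 1" using \<open>odd p\<close> by (elim oddE)
  have "of_int ii_sign * \<i> = \<i> ^ p"
    using assms p'_root_of_unity_ii f_ii by (simp add: is_sigma_def)
  also have "\<dots> = of_int ((- 1) ^ h) * \<i>"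
    by (simp add: h power_add power_mult)
  finally have "ii_sign = (- 1) ^ h" by (simp only: mult_cancel_right of_int_eq_iff complex_i_not_zero simp_thms)
  then show ?thesis by (simp add: h)
qed

text \<open>For an odd prime \<open>q\<close> the Gauss sum yields the symbol of \<open>p\<close>
  modulo \<open>q\<close>, which reciprocity inverts; for \<open>q = 2\<close> both sides depend
  only on \<open>p\<close> modulo 8.\<close>

lemma sigma_sqrt_sign:
  assumes "is_sigma p f" "prime p" "odd p" "l > 0" "\<not> p dvd l"
  shows "sqrt_sign l = Legendre l p"
proof (rule sqrt_sign_eq_multiplicative[of "\<lambda>l. Legendre (int l) (int p)"])
  have "p > 2" using assms(2,3) prime_ge_2_nat[of p] by (cases "p = 2") auto
  have sigma: "f (unit_root n 1) = unit_root n p" if "n > 0" "coprime n p" for n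
    using assms(1) p'_root_of_unity_unit_root[OF that] by (simp add: is_sigma_def unit_root_power)
  show "Legendre (int 1) (int p) = 1" using \<open>p > 2\<close> by (simp add: Legendre_1)
  show "Legendre (int (m * n)) (int p) = Legendre (int m) (int p) * Legendre (int n) (int p)" for m n
    using Legendre_mult[OF \<open>prime p\<close> \<open>p > 2\<close>] by simp
  fix q :: nat assume q: "prime q" "q \<noteq> p"
  show "sqrt_sign q = Legendre (int q) (int p)"
  proof (cases "q = 2")
    case True
    have "int p mod 8 = int (p mod 8)" by (simp add: zmod_int)
    then have "int p mod 8 \<in> {1, 7} \<longleftrightarrow> p mod 8 \<in> {1, 7}" by auto
    then show ?thesis
      using coprime_power_of_2[OF \<open>odd p\<close>] sqrt_sign_2[OF sigma] Legendre_2_eq[OF \<open>prime p\<close> \<open>p > 2\<close>] \<open>odd p\<close> True by simp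
  next
    case False
    then have "q > 2" using q prime_ge_2_nat[of q] by simp
    have "\<not> q dvd p" "\<not> p dvd q" using q \<open>prime p\<close> primes_dvd_imp_eq by blast+
    then have "\<not> int q dvd int p" "\<not> int p dvd int q" by simp_all
    have "sqrt_sign q = Legendre p q * ii_sign ^ ((q - 1) div 2)"
      using q \<open>q > 2\<close> \<open>\<not> int q dvd int p\<close> \<open>prime p\<close>
      by (intro sqrt_sign_odd_prime sigma primes_coprime) auto
    \<comment> \<open>The power of \<open>ii_sign\<close> is exactly the sign in the reciprocity
      law, hence the product of the two symbols.\<close>
    also have "\<dots> = Legendre p q * (Legendre p q * Legendre q p)"
      using Quadratic_Reciprocity[OF \<open>prime p\<close> \<open>p > 2\<close> \<open>prime q\<close> \<open>q > 2\<close>] q(2)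
        sigma_ii_sign[OF assms(1,3)] by (simp add: power_mult)
    also have "\<dots> = Legendre q p"
      using Legendre_square[OF \<open>prime q\<close> \<open>q > 2\<close> \<open>\<not> int q dvd int p\<close>] by (simp flip: mult.assoc)
    finally show ?thesis .
  qed
qed (use assms in simp_all)

end

section \<open>Partitions and Frobenius symbols\<close>

text \<open>The Maya diagram of charge 0; the rows beyond the last part contribute all sufficiently
  negative integers.\<close>

definition beads :: "(nat \<Rightarrow> nat) \<Rightarrow> int set" where
  "beads P = range (\<lambda>i. int (P i) - int i - 1)"

text \<open>As \<open>P\<close> decreases, the rows longer than \<open>j\<close> form an initial
  segment, whose length is the height of column \<open>j\<close>.\<close>

lemma less_conjugate_iff:
  assumes "int_partition P"
  shows "i < conjugate P j \<longleftrightarrow> j < P i"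
proof -
  have fin: "finite {i. j < P i}"
    using assms unfolding int_partition_def by (auto elim: rev_finite_subset)
  have down: "i' \<in> {i. j < P i}" if "i \<in> {i. j < P i}" "i' \<le> i" for i i'
    using that assms unfolding int_partition_def by (auto dest: antimonoD order_less_le_trans)
  obtain n where n: "{i. j < P i} = {..<n}"
  proof -
    define n where "n = (LEAST n. n \<notin> {i. j < P i})"
    have "\<exists>n. n \<notin> {i. j < P i}" using fin ex_new_if_finite infinite_UNIV_nat by blast
    then have "n \<notin> {i. j < P i}" unfolding n_def by (rule LeastI_ex)
    moreover have "i \<in> {i. j < P i}" if "i < n" for i using not_less_Least that unfolding n_def by blast
    ultimately have "{i. j < P i} = {..<n}" using down by (meson lessThan_iff not_less Set.set_eqI)
    then show ?thesis using that by blast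
  qed
  then have "conjugate P j = n" by (simp add: conjugate_def)
  then show ?thesis using n by (metis lessThan_iff mem_Collect_eq)
qed

text \<open>The vertical steps of the boundary path of the Young diagram are \<open>P i - i - 1\<close>, the horizontal ones are
  \<open>j - conjugate P j\<close>; every step is of exactly one kind.\<close>

lemma not_in_beads_iff:
  assumes P: "int_partition P"
  shows "m \<notin> beads P \<longleftrightarrow> (\<exists>j. m = int j - int (conjugate P j))"
proof
  assume m: "m \<notin> beads P"
  obtain N where N: "P i = 0" if "i \<ge> N" for i
  proof -
    have "finite {i. P i \<noteq> 0}" using P by (simp add: int_partition_def)
    then obtain N where "\<forall>i\<in>{i. P i \<noteq> 0}. i < N" using finite_nat_set_iff_bounded by blast
    then show ?thesis using that by (metis linorder_not_le mem_Collect_eq)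
  qed
  have "int (P (N + nat (- m))) - int (N + nat (- m)) - 1 \<le> m" using N by simp
  then have ex: "\<exists>i. int (P i) - int i - 1 \<le> m" by blast
  \<comment> \<open>Rows before \<open>i\<close> have their bead above \<open>m\<close> and row
    \<open>i\<close> has it below, so column \<open>m + i\<close> has height exactly
    \<open>i\<close>.\<close>
  define i where "i = (LEAST i. int (P i) - int i - 1 \<le> m)"
  have "int (P i) - int i - 1 \<le> m" unfolding i_def by (rule LeastI_ex[OF ex])
  then have i: "int (P i) - int i - 1 < m" using m by (auto simp: beads_def order_le_less)
  define j where "j = nat (m + int i)"
  have j: "int j = m + int i" using i by (simp add: j_def)
  have "\<not> i < conjugate P j" using i j by (simp add: less_conjugate_iff[OF P])
  moreover have "i \<le> conjugate P j"
  proof (cases i)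
    case (Suc k)
    then have "\<not> int (P k) - int k - 1 \<le> m" using not_less_Least[of k "\<lambda>i. int (P i) - int i - 1 \<le> m"]
      by (simp add: i_def)
    then have "k < conjugate P j" using j Suc by (simp add: less_conjugate_iff[OF P])
    then show ?thesis using Suc by simp
  qed simp
  ultimately have "conjugate P j = i" by simp
  then show "\<exists>j. m = int j - int (conjugate P j)" using j by (intro exI[of _ j]) simp
next
  assume "\<exists>j. m = int j - int (conjugate P j)"
  then obtain j where j: "m = int j - int (conjugate P j)" ..
  show "m \<notin> beads P"
  proof
    assume "m \<in> beads P"
    then obtain i where "m = int (P i) - int i - 1" by (auto simp: beads_def)
    then show False using j less_conjugate_iff[OF P, of i j] by (cases "j < P i") linarith+
  qed
qed

lemma frobenius_arms_eq: "frobenius_arms P = {x. int x \<in> beads P}"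
proof -
  have "x \<in> frobenius_arms P \<longleftrightarrow> int x \<in> beads P" for x
    unfolding frobenius_arms_def beads_def image_iff mem_Collect_eq bex_UNIV by (intro ex_cong1) auto
  then show ?thesis by blast
qed

lemma frobenius_legs_eq:
  assumes "int_partition P"
  shows "frobenius_legs P = {x. - 1 - int x \<notin> beads P}"
proof -
  have "x \<in> frobenius_legs P \<longleftrightarrow> - 1 - int x \<notin> beads P" for x
    unfolding not_in_beads_iff[OF assms] frobenius_legs_def mem_Collect_eq by (intro ex_cong1) auto
  then show ?thesis by blast
qed

text \<open>The index of a value is the number of larger values in the range, so the range
  determines the sequence.\<close>

lemma strictly_decreasing_enumeration_unique:
  fixes g h :: "nat \<Rightarrow> int"
  assumes g: "\<And>i j. i < j \<Longrightarrow> g j < g i" and h: "\<And>i j. i < j \<Longrightarrow> h j < h i"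
    and range: "range g = range h"
  shows "g = h"
proof
  fix i
  obtain j where j: "g i = h j" using range by (metis rangeE rangeI)
  have above: "{s \<in> range k. s > k n} = k ` {..<n}" "inj_on k {..<n}"
    if "\<And>i j. i < j \<Longrightarrow> k j < k i" for k :: "nat \<Rightarrow> int" and n
  proof -
    have less: "k b < k a \<longleftrightarrow> a < b" for a b
      using that[of a b] that[of b a] by (cases a b rule: linorder_cases) auto
    then show "{s \<in> range k. s > k n} = k ` {..<n}" by auto
    show "inj_on k {..<n}"
    proof (rule inj_onI)
      fix a b assume "k a = k b"
      then show "a = b" using less[of a b] less[of b a] by auto
    qed
  qed
  have "card (g ` {..<i}) = card (h ` {..<j})"
    using above(1)[where k = g and n = i, OF g] above(1)[where k = h and n = j, OF h] range j by simp
  then have "i = j" using above(2)[where k = g and n = i, OF g] above(2)[where k = h and n = j, OF h] by (simp add: card_image)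
  then show "g i = h i" using j by simp
qed

lemma beads_inject:
  assumes "int_partition P" "int_partition Q" "beads P = beads Q"
  shows "P = Q"
proof -
  have decr: "int (R j) - int j - 1 < int (R i) - int i - 1" if "int_partition R" "i < j" for R i j
    using that antimonoD[of R i j] by (simp add: int_partition_def)
  have "(\<lambda>i. int (P i) - int i - 1) = (\<lambda>i. int (Q i) - int i - 1)"
    using assms decr by (intro strictly_decreasing_enumeration_unique) (auto simp: beads_def)
  then show ?thesis by (simp add: fun_eq_iff)
qed

section \<open>Bead configurations with a prescribed Frobenius symbol\<close>

definition bead_set :: "nat set \<Rightarrow> nat set \<Rightarrow> int set" where
  "bead_set A B = int ` A \<union> {- 1 - int x | x. x \<notin> B}"

lemma bead_set_iff:
  "int x \<in> bead_set A B \<longleftrightarrow> x \<in> A" "- 1 - int x \<in> bead_set A B \<longleftrightarrow> x \<notin> B"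
  by (auto simp: bead_set_def)

lemma int_cases_bead: obtains (nonneg) x where "m = int x" | (neg) x where "m = - 1 - int x"
proof (cases "m \<ge> 0")
  case True then show ?thesis using nonneg[of "nat m"] by simp
next
  case False then show ?thesis using neg[of "nat (- 1 - m)"] by simp
qed

lemma bead_set_eqI:
  assumes "\<And>x. int x \<in> S \<longleftrightarrow> x \<in> A" "\<And>x. - 1 - int x \<in> S \<longleftrightarrow> x \<notin> B"
  shows "S = bead_set A B"
proof (rule Set.set_eqI)
  fix m
  show "m \<in> S \<longleftrightarrow> m \<in> bead_set A B"
    by (cases m rule: int_cases_bead) (simp_all add: assms bead_set_iff)
qed

lemma beads_eq_iff:
  assumes "int_partition P"
  shows "beads P = bead_set A B \<longleftrightarrow> frobenius_arms P = A \<and> frobenius_legs P = B"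
proof
  assume "beads P = bead_set A B"
  then show "frobenius_arms P = A \<and> frobenius_legs P = B"
    by (simp add: frobenius_arms_eq frobenius_legs_eq[OF assms] bead_set_iff)
next
  assume "frobenius_arms P = A \<and> frobenius_legs P = B"
  then show "beads P = bead_set A B"
    by (intro bead_set_eqI) (auto simp: frobenius_arms_eq frobenius_legs_eq[OF assms])
qed

text \<open>Positions are read downwards from \<open>N - 1\<close>, above which there are no beads.
  The part belonging to a bead is the number of gaps at lower positions.\<close>

lemma exists_partition_with_beads:
  assumes "finite A" "finite B" "card A = card B"
  obtains P where "int_partition P" "beads P = bead_set A B"
proof -
  obtain N where N: "\<forall>a\<in>A. a < N" using assms(1) finite_nat_set_iff_bounded by blast
  obtain K where K: "\<forall>b\<in>B. b < K" using assms(2) finite_nat_set_iff_bounded by blast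
  define T where "T = {t. int N - 1 - int t \<in> bead_set A B}"
  have T_ge: "t \<in> T" if "t \<ge> N + K" for t
  proof -
    have "int N - 1 - int t = - 1 - int (t - N)" "t - N \<notin> B" using that K by force+
    then show ?thesis by (simp only: T_def mem_Collect_eq bead_set_iff) simp
  qed
  then have inf: "infinite T" by (metis infinite_nat_iff_unbounded_le nat_le_linear)
  \<comment> \<open>The gaps are the nonnegative positions outside \<open>A\<close> and the negative
    ones given by \<open>B\<close>; since \<open>card A = card B\<close>, there are exactly
    \<open>N\<close> of them.\<close>
  have compl: "- T = (\<lambda>x. N - 1 - x) ` ({..<N} - A) \<union> (\<lambda>x. N + x) ` B"
  proof (rule Set.set_eqI)
    fix t
    show "t \<in> - T \<longleftrightarrow> t \<in> (\<lambda>x. N - 1 - x) ` ({..<N} - A) \<union> (\<lambda>x. N + x) ` B"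
    proof (cases "t < N")
      case True
      then have "int N - 1 - int t = int (N - 1 - t)" by simp
      then have "t \<in> T \<longleftrightarrow> N - 1 - t \<in> A" by (simp only: T_def mem_Collect_eq bead_set_iff)
      moreover have "t \<in> (\<lambda>x. N - 1 - x) ` ({..<N} - A) \<longleftrightarrow> N - 1 - t \<notin> A"
        using True by (auto intro!: image_eqI[of _ _ "N - 1 - t"])
      ultimately show ?thesis using True by auto
    next
      case False
      then have "int N - 1 - int t = - 1 - int (t - N)" by simp
      then have "t \<in> T \<longleftrightarrow> t - N \<notin> B" by (simp only: T_def mem_Collect_eq bead_set_iff)
      then show ?thesis using False by (force intro: image_eqI[of _ _ "t - N"])
    qed
  qed
  have "card (- T) = card ((\<lambda>x. N - 1 - x) ` ({..<N} - A)) + card ((\<lambda>x. N + x) ` B)"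
    unfolding compl using assms by (intro card_Un_disjoint) auto
  also have "\<dots> = card ({..<N} - A) + card B"
    by (intro arg_cong2[of _ _ _ _ "(+)"] card_image) (auto simp: inj_on_def)
  also have "\<dots> = N"
    using N assms card_mono[of "{..<N}" A] by (subst card_Diff_subset) (auto simp: subset_iff)
  finally have card_compl: "card (- T) = N" .
  have fin_compl: "finite (- T)" unfolding compl using assms by simp
  define e where "e = enumerate T"
  have e_mono: "e i < e j" if "i < j" for i j
    using that inf by (simp add: e_def enumerate_mono)
  have e_range: "range e = T" using inf by (simp add: e_def range_enumerate)
  \<comment> \<open>Of the indices below \<open>e i\<close>, exactly \<open>i\<close> are occupied
    and the others are gaps.\<close>
  have below: "e i = i + card (- T \<inter> {..<e i})" for i
  proof -
    have "{..<e i} = e ` {..<i} \<union> (- T \<inter> {..<e i})"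
    proof
      show "{..<e i} \<subseteq> e ` {..<i} \<union> (- T \<inter> {..<e i})"
      proof
        fix t assume t: "t \<in> {..<e i}"
        show "t \<in> e ` {..<i} \<union> (- T \<inter> {..<e i})"
        proof (cases "t \<in> T")
          case True
          then obtain j where "t = e j" using e_range by blast
          then show ?thesis using t e_mono[of i j] by (cases i j rule: linorder_cases) auto
        qed (use t in simp)
      qed
    qed (use e_mono in auto)
    moreover have "e ` {..<i} \<inter> (- T \<inter> {..<e i}) = {}" using e_range by auto
    ultimately have "card {..<e i} = card (e ` {..<i}) + card (- T \<inter> {..<e i})"
      using fin_compl by (metis card_Un_disjoint finite_Int finite_imageI finite_lessThan)
    also have "card (e ` {..<i}) = i"
      using inf by (subst card_image) (auto simp: e_def intro: inj_on_subset[OF inj_enumerate])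
    finally show ?thesis by simp
  qed
  have e_le: "e i \<le> i + N" for i
    using below[of i] card_mono[OF fin_compl, of "- T \<inter> {..<e i}"] card_compl by simp
  have e_ge: "i \<le> e i" for i using below[of i] by simp
  \<comment> \<open>The number of gaps with index above \<open>e i\<close>; \<open>e_le\<close>
    excludes truncation.\<close>
  define P where "P i = i + N - e i" for i
  have bead: "int (P i) - int i - 1 = int N - 1 - int (e i)" for i
    using e_le[of i] by (simp add: P_def)
  have "P i = 0" if "i \<ge> N + K" for i
  proof -
    have "t < e i" if "t \<notin> T" for t
      using T_ge[of t] e_ge[of i] that \<open>i \<ge> N + K\<close> by (cases "t \<ge> N + K") auto
    then have "- T \<inter> {..<e i} = - T" by auto
    then show ?thesis using below[of i] card_compl by (simp add: P_def)
  qed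
  then have "{i. P i \<noteq> 0} \<subseteq> {..<N + K}" by (metis (mono_tags, lifting) lessThan_iff mem_Collect_eq not_le subsetI)
  then have "finite {i. P i \<noteq> 0}" by (rule finite_subset) simp
  moreover have "P (Suc i) \<le> P i" for i
    using e_mono[of i "Suc i"] by (simp add: P_def)
  then have "antimono P" by (simp add: antimono_iff_le_Suc)
  ultimately have "int_partition P" by (simp add: int_partition_def)
  moreover have "beads P = bead_set A B"
  proof -
    have "beads P = (\<lambda>t. int N - 1 - int t) ` T"
      unfolding beads_def bead e_range[symmetric] by auto
    also have "\<dots> = bead_set A B"
    proof
      show "bead_set A B \<subseteq> (\<lambda>t. int N - 1 - int t) ` T"
      proof
        fix m assume m: "m \<in> bead_set A B"
        then have "m < int N" using N by (auto simp: bead_set_def)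
        then show "m \<in> (\<lambda>t. int N - 1 - int t) ` T"
          using m by (intro image_eqI[of _ _ "nat (int N - 1 - m)"]) (auto simp: T_def)
      qed
    qed (auto simp: T_def)
    finally show ?thesis .
  qed
  ultimately show ?thesis using that by blast
qed

lemma partition_of_frobenius:
  assumes "finite A" "finite B" "card A = card B"
  shows "int_partition (partition_of_frobenius A B)"
    and "frobenius_arms (partition_of_frobenius A B) = A"
    and "frobenius_legs (partition_of_frobenius A B) = B"
proof -
  obtain P where P: "int_partition P" "beads P = bead_set A B"
    using exists_partition_with_beads[OF assms] by blast
  then have "\<exists>!P. int_partition P \<and> frobenius_arms P = A \<and> frobenius_legs P = B"
    using beads_eq_iff beads_inject by (metis (no_types, lifting))
  from theI'[OF this] show "int_partition (partition_of_frobenius A B)"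
    "frobenius_arms (partition_of_frobenius A B) = A" "frobenius_legs (partition_of_frobenius A B) = B"
    by (auto simp: partition_of_frobenius_def)
qed

section \<open>Runners, core and cocore\<close>

text \<open>Cut off at \<open>- K\<close>, the charge and the energy of a bead configuration become a finite cardinality and a
  finite sum, on which a shift acts in the obvious way.\<close>

lemma bead_set_window:
  assumes "finite A" "B \<subseteq> {..<K}"
  shows "finite (bead_set A B \<inter> {- int K..})"
    and "int (card (bead_set A B \<inter> {- int K..})) = int (card A) + int K - int (card B)"
    and "2 * \<Sum>(bead_set A B \<inter> {- int K..})
           = 2 * (int (\<Sum>A) + int (\<Sum>B) + int (card B)) - int K * (int K + 1)"
proof -
  let ?N = "(\<lambda>x. - 1 - int x) ` ({..<K} - B)"
  have eq: "bead_set A B \<inter> {- int K..} = int ` A \<union> ?N"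
    by (auto simp: bead_set_def)
  have fin: "finite (int ` A)" "finite ?N" and disj: "int ` A \<inter> ?N = {}"
    using assms by auto
  have "finite B" using assms(2) finite_subset by blast
  have "card B \<le> K" using card_mono[OF _ assms(2)] by simp
  show "finite (bead_set A B \<inter> {- int K..})" unfolding eq using fin by blast
  have "card ?N = K - card B"
    using assms(2) \<open>finite B\<close> by (subst card_image) (auto simp: inj_on_def card_Diff_subset)
  then show "int (card (bead_set A B \<inter> {- int K..})) = int (card A) + int K - int (card B)"
    unfolding eq card_Un_disjoint[OF fin disj] using \<open>card B \<le> K\<close> by (simp add: card_image)
  have "\<Sum>?N = (\<Sum>x\<in>{..<K} - B. - 1 - int x)"
    by (subst sum.reindex) (auto simp: inj_on_def)
  also have "\<dots> = (\<Sum>x<K. - 1 - int x) - (\<Sum>x\<in>B. - 1 - int x)"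
    using assms(2) by (intro sum_diff) auto
  also have "(\<Sum>x\<in>B. - 1 - int x) = - int (card B) - int (\<Sum>B)"
    by (simp add: sum_subtractf)
  also have "2 * ((\<Sum>x<K. - 1 - int x) - (- int (card B) - int (\<Sum>B)))
      = 2 * (int (\<Sum>B) + int (card B)) - int K * (int K + 1)"
  proof -
    have "2 * (\<Sum>x<K. - 1 - int x) = - int K * (int K + 1)"
      by (induction K) (simp_all add: algebra_simps)
    then show ?thesis by simp
  qed
  finally have "2 * \<Sum>?N = 2 * (int (\<Sum>B) + int (card B)) - int K * (int K + 1)" by simp
  moreover have "\<Sum>(int ` A) = int (\<Sum>A)" by (simp add: sum.reindex)
  ultimately show "2 * \<Sum>(bead_set A B \<inter> {- int K..})
           = 2 * (int (\<Sum>A) + int (\<Sum>B) + int (card B)) - int K * (int K + 1)"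
    unfolding eq sum.union_disjoint[OF fin disj] by (simp add: algebra_simps)
qed

text \<open>The shift takes the window from \<open>- K\<close> to the one from
  \<open>- K - c\<close>. Comparing the numbers of beads gives equally many arms and legs; comparing
  their sums gives the term \<open>c * (c - 1)\<close>.\<close>

lemma bead_set_shift:
  assumes fin: "finite X" "finite Y"
    and shift: "bead_set A B = (\<lambda>m. m - c) ` bead_set X Y"
    and c: "c = int (card X) - int (card Y)"
  shows "finite A" "finite B" "card A = card B"
    and "2 * (int (\<Sum>X) + int (\<Sum>Y) + int (card Y))
           = 2 * (int (\<Sum>A) + int (\<Sum>B) + int (card B)) + c * (c - 1)"
proof -
  have mem: "m \<in> bead_set A B \<longleftrightarrow> m + c \<in> bead_set X Y" for m
    unfolding shift by (auto intro!: image_eqI[of m _ "m + c"])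
  \<comment> \<open>Beyond \<open>\<bar>c\<bar>\<close> an arm can come only from a nonnegative
    bead, that is, from an element of \<open>X\<close>; legs and \<open>Y\<close> are treated
    likewise.\<close>
  have "A \<subseteq> nat ` (\<lambda>x. int x - c) ` X \<union> {..nat \<bar>c\<bar>}"
  proof
    fix x assume "x \<in> A"
    then have "int x + c \<in> bead_set X Y" using mem bead_set_iff(1) by blast
    then consider y where "y \<in> X" "int x + c = int y" | "int x + c < 0"
      by (auto simp: bead_set_def)
    then show "x \<in> nat ` (\<lambda>x. int x - c) ` X \<union> {..nat \<bar>c\<bar>}"
    proof cases
      case 1
      then have "x = nat (int y - c)" by simp
      then show ?thesis using 1(1) by blast
    qed auto
  qed
  then show "finite A" using fin finite_subset by blast
  have "B \<subseteq> nat ` (\<lambda>y. int y + c) ` Y \<union> {..nat \<bar>c\<bar>}"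
  proof
    fix x assume "x \<in> B"
    then have notin: "- 1 - int x + c \<notin> bead_set X Y" using mem bead_set_iff(2) by blast
    show "x \<in> nat ` (\<lambda>y. int y + c) ` Y \<union> {..nat \<bar>c\<bar>}"
    proof (cases "int x - c \<ge> 0")
      case True
      then have "- 1 - int x + c = - 1 - int (nat (int x - c))" by simp
      then have "nat (int x - c) \<in> Y" using notin bead_set_iff(2) by metis
      moreover have "x = nat (int (nat (int x - c)) + c)" using True by simp
      ultimately show ?thesis by blast
    qed auto
  qed
  then show "finite B" using fin finite_subset by blast
  obtain k1 where k1: "\<forall>y\<in>Y. y < k1" using fin(2) finite_nat_set_iff_bounded by blast
  obtain k2 where k2: "\<forall>y\<in>B. y < k2" using \<open>finite B\<close> finite_nat_set_iff_bounded by blast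
  \<comment> \<open>Large enough that \<open>K\<close> bounds \<open>Y\<close>, while
    \<open>K + c\<close> is nonnegative and bounds \<open>B\<close>.\<close>
  define K where "K = k1 + k2 + nat \<bar>c\<bar>"
  define K' where "K' = nat (int K + c)"
  have K': "int K' = int K + c" by (simp add: K'_def K_def)
  have Y: "Y \<subseteq> {..<K}" using k1 by (auto simp: K_def)
  have B: "B \<subseteq> {..<K'}" using k2 by (fastforce simp: K_def K'_def)
  define W where "W = bead_set X Y \<inter> {- int K..}"
  have W': "bead_set A B \<inter> {- int K'..} = (\<lambda>m. m - c) ` W"
    unfolding shift W_def K' by auto
  note window = bead_set_window[OF fin(1) Y, folded W_def]
  note window' = bead_set_window[OF \<open>finite A\<close> B, unfolded W']
  have "card ((\<lambda>m. m - c) ` W) = card W" by (simp add: card_image)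
  then show "card A = card B" using window(2) window'(2) c K' by simp
  have "int (card W) = int K'" using window(2) c K' by simp
  then have "\<Sum>((\<lambda>m. m - c) ` W) = \<Sum>W - c * int K'"
    by (simp add: sum.reindex sum_subtractf)
  then have "2 * (int (\<Sum>A) + int (\<Sum>B) + int (card B)) - int K' * (int K' + 1)
      = 2 * (int (\<Sum>X) + int (\<Sum>Y) + int (card Y)) - int K * (int K + 1) - 2 * (c * int K')"
    using window(3) window'(3) by simp
  moreover have "int K' * (int K' + 1) - int K * (int K + 1) - 2 * (c * int K') = - (c * (c - 1))"
    unfolding K' by (simp add: algebra_simps)
  ultimately show "2 * (int (\<Sum>X) + int (\<Sum>Y) + int (card Y))
           = 2 * (int (\<Sum>A) + int (\<Sum>B) + int (card B)) + c * (c - 1)" by linarith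
qed

section \<open>Core and cocore through their runners\<close>

lemma bar_runner_eqI:
  assumes "t > 0" "\<And>r. r < t \<Longrightarrow> bar_runner t L r = bar_runner t M r"
  shows "L = M"
proof (rule Set.set_eqI)
  fix l
  have "l \<in> S \<longleftrightarrow> l div t \<in> bar_runner t S (l mod t)" for S
    by (simp add: bar_runner_def)
  then show "l \<in> L \<longleftrightarrow> l \<in> M" using assms by simp
qed

lemma finite_bar_runner:
  assumes "finite L" "t > 0"
  shows "finite (bar_runner t L r)"
proof (rule finite_imageD)
  show "finite ((\<lambda>x. t * x + r) ` bar_runner t L r)"
    using assms(1) by (rule rev_finite_subset) (auto simp: bar_runner_def)
qed (use assms(2) in \<open>simp add: inj_on_def\<close>)

text \<open>For odd \<open>t\<close> no nonzero residue is its own negative.\<close>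

lemma odd_residues:
  assumes "odd (t::nat)"
  shows "{..<t} = insert 0 ({1..(t - 1) div 2} \<union> (\<lambda>r. t - r) ` {1..(t - 1) div 2})" (is "_ = insert 0 (?H \<union> ?H')")
    and "{1..(t - 1) div 2} \<inter> (\<lambda>r. t - r) ` {1..(t - 1) div 2} = {}"
proof -
  obtain h where h: "t = 2 * h + 1" using assms by (elim oddE)
  show "{..<t} = insert 0 (?H \<union> ?H')"
  proof
    show "{..<t} \<subseteq> insert 0 (?H \<union> ?H')"
    proof
      fix r assume "r \<in> {..<t}"
      then show "r \<in> insert 0 (?H \<union> ?H')"
        by (cases "r \<le> h") (auto simp: h intro!: image_eqI[of r _ "t - r"])
    qed
  qed (auto simp: h)
  show "?H \<inter> ?H' = {}" by (auto simp: h)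
qed

text \<open>The setting of an arbitrary commutative monoid covers both sums over the parts and
  products of their signs.\<close>

lemma (in comm_monoid_set) bar_runners:
  assumes "finite L" "odd t"
  shows "F g L = F (\<lambda>x. g (t * x)) (bar_runner t L 0) \<^bold>*
    F (\<lambda>r. F (\<lambda>x. g (t * x + r)) (bar_runner t L r) \<^bold>*
            F (\<lambda>x. g (t * x + (t - r))) (bar_runner t L (t - r))) {1..(t - 1) div 2}"
proof -
  have "t > 0" using assms(2) by (simp add: odd_pos)
  define G where "G r = F (\<lambda>x. g (t * x + r)) (bar_runner t L r)" for r
  have "F g L = F (\<lambda>r. F g {l \<in> L. l mod t = r}) {..<t}"
    using assms(1) \<open>t > 0\<close> by (intro group[symmetric]) auto
  also have "\<dots> = F G {..<t}"
  proof (rule cong)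
    fix r assume "r \<in> {..<t}"
    then have "{l \<in> L. l mod t = r} = (\<lambda>x. t * x + r) ` bar_runner t L r"
    proof -
      have "l \<in> (\<lambda>x. t * x + r) ` bar_runner t L r" if "l \<in> L" "l mod t = r" for l
        using that by (intro image_eqI[of _ _ "l div t"]) (auto simp: bar_runner_def)
      then show ?thesis using \<open>r \<in> {..<t}\<close> by (auto simp: bar_runner_def)
    qed
    moreover have "inj_on (\<lambda>x. t * x + r) (bar_runner t L r)"
      using \<open>t > 0\<close> by (simp add: inj_on_def)
    ultimately show "F g {l \<in> L. l mod t = r} = G r"
      by (simp add: reindex G_def comp_def)
  qed simp
  also have "\<dots> = G 0 \<^bold>* F G ({1..(t - 1) div 2} \<union> (\<lambda>r. t - r) ` {1..(t - 1) div 2})"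
    unfolding odd_residues(1)[OF assms(2)] using \<open>t > 0\<close> by (intro insert) auto
  also have "F G ({1..(t - 1) div 2} \<union> (\<lambda>r. t - r) ` {1..(t - 1) div 2})
      = F G {1..(t - 1) div 2} \<^bold>* F G ((\<lambda>r. t - r) ` {1..(t - 1) div 2})"
    using odd_residues(2)[OF assms(2)] by (intro union_disjoint) auto
  also have "F G ((\<lambda>r. t - r) ` {1..(t - 1) div 2}) = F (\<lambda>r. G (t - r)) {1..(t - 1) div 2}"
    by (subst reindex) (auto simp: inj_on_def comp_def)
  finally show ?thesis by (simp add: G_def distrib)
qed

text \<open>The pair of runners \<open>r\<close> and \<open>t - r\<close> takes the place of arms
  and legs, so the results on bead sets apply to it.\<close>

lemma twisted_runner_eq:
  "twisted_runner t L r = bead_set (bar_runner t L r) (bar_runner t L (t - r))"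
  by (simp add: twisted_runner_def bead_set_def)

text \<open>The Frobenius data of the quotient component, kept as sets so that they can be compared
  directly with runners.\<close>

definition arms where "arms t L r = {x. int x \<in> shifted_runner t L r}"
definition legs where "legs t L r = {x. - 1 - int x \<notin> shifted_runner t L r}"

lemma shifted_runner_eq: "shifted_runner t L r = bead_set (arms t L r) (legs t L r)"
  by (rule bead_set_eqI) (simp_all add: arms_def legs_def)

lemma arms_legs:
  fixes r :: nat
  assumes "finite L" "t > 0"
  defines "X \<equiv> bar_runner t L r" and "Y \<equiv> bar_runner t L (t - r)"
    and "A \<equiv> arms t L r" and "B \<equiv> legs t L r" and "c \<equiv> bar_char t L r"
  shows "finite A" "finite B" "card A = card B"
    "2 * (int (\<Sum>X) + int (\<Sum>Y) + int (card Y)) = 2 * (int (\<Sum>A) + int (\<Sum>B) + int (card B)) + c * (c - 1)"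
proof -
  have "finite X" "finite Y" unfolding X_def Y_def using assms(1,2) by (simp_all add: finite_bar_runner)
  moreover have "bead_set A B = (\<lambda>m. m - c) ` bead_set X Y"
    unfolding A_def B_def shifted_runner_eq[symmetric] X_def Y_def c_def
    by (simp add: shifted_runner_def twisted_runner_eq)
  moreover have "c = int (card X) - int (card Y)"
    by (simp add: c_def bar_char_def X_def Y_def)
  ultimately show "finite A" "finite B" "card A = card B"
    "2 * (int (\<Sum>X) + int (\<Sum>Y) + int (card Y)) = 2 * (int (\<Sum>A) + int (\<Sum>B) + int (card B)) + c * (c - 1)"
    by (rule bead_set_shift)+
qed

lemma bar_core_iff:
  assumes "t > 0" "s < t"
  shows "t * x + s \<in> bar_core t L \<longleftrightarrow>
    (\<exists>r\<in>{1..(t - 1) div 2}. s = r \<and> int x < bar_char t L r \<or> s = t - r \<and> int x < - bar_char t L r)"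
proof -
  have unique: "t * x + s = r + j * t \<longleftrightarrow> s = r \<and> x = j" if "r < t" for r j
  proof
    assume eq: "t * x + s = r + j * t"
    have "(t * x + s) mod t = s" "(t * x + s) div t = x" using assms by auto
    moreover have "(r + j * t) mod t = r" "(r + j * t) div t = j" using assms that by auto
    ultimately show "s = r \<and> x = j" using eq by simp
  qed (simp add: mult.commute)
  have "t * x + s \<in> (if bar_char t L r > 0 then {r + j * t | j. int j < bar_char t L r}
        else if bar_char t L r < 0 then {(t - r) + j * t | j. int j < \<bar>bar_char t L r\<bar>}
        else {}) \<longleftrightarrow> s = r \<and> int x < bar_char t L r \<or> s = t - r \<and> int x < - bar_char t L r"
    if "r \<in> {1..(t - 1) div 2}" for r
  proof -
    have "r < t" "t - r < t" using that assms(1) by auto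
    then have "t * x + s \<in> {u + j * t | j. int j < c} \<longleftrightarrow> s = u \<and> int x < c" if "u \<in> {r, t - r}" for u c
    proof -
      have "u < t" using that \<open>r < t\<close> \<open>t - r < t\<close> by blast
      show ?thesis unfolding mem_Collect_eq unique[OF \<open>u < t\<close>] by auto
    qed
    from this[of r] this[of "t - r"] show ?thesis
      by (cases "bar_char t L r" "0::int" rule: linorder_cases) simp_all
  qed
  then show ?thesis unfolding bar_core_def UN_iff by (intro bex_cong refl)
qed

text \<open>\<open>nat\<close> turns a negative length into 0, so the three cases in the definition
  of the core merge, and at most one of two paired runners is nonempty.\<close>

lemma bar_runner_core:
  assumes "odd t"
  shows "bar_runner t (bar_core t L) 0 = {}"
    and "r \<in> {1..(t - 1) div 2} \<Longrightarrow> bar_runner t (bar_core t L) r = {..<nat (bar_char t L r)}"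
    and "r \<in> {1..(t - 1) div 2} \<Longrightarrow> bar_runner t (bar_core t L) (t - r) = {..<nat (- bar_char t L r)}"
proof -
  have "t > 0" using assms by (simp add: odd_pos)
  note iff = bar_core_iff[OF \<open>t > 0\<close>]
  show "bar_runner t (bar_core t L) 0 = {}"
    using iff[of 0] \<open>t > 0\<close> by (auto simp: bar_runner_def)
  have inj: "t - r = t - s \<longleftrightarrow> r = s" "r \<noteq> t - s"
    if "r \<in> {1..(t - 1) div 2}" "s \<in> {1..(t - 1) div 2}" for r s
    using that \<open>t > 0\<close> by auto
  assume r: "r \<in> {1..(t - 1) div 2}"
  then have "r < t" "t - r < t" using \<open>t > 0\<close> by auto
  show "bar_runner t (bar_core t L) r = {..<nat (bar_char t L r)}"
    unfolding bar_runner_def iff[OF \<open>r < t\<close>] using r inj by auto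
  show "bar_runner t (bar_core t L) (t - r) = {..<nat (- bar_char t L r)}"
    unfolding bar_runner_def iff[OF \<open>t - r < t\<close>] using r inj by auto
qed

lemma bar_char_eq_0_if_core_empty:
  assumes "odd t" "bar_core t L = {}" "r \<in> {1..(t - 1) div 2}"
  shows "bar_char t L r = 0"
proof -
  have "bar_runner t (bar_core t L) s = {}" for s
    by (simp add: bar_runner_def assms(2))
  then have "{..<nat (bar_char t L r)} = {}" "{..<nat (- bar_char t L r)} = {}"
    using bar_runner_core(2,3)[OF assms(1,3), of L] by metis+
  then have "nat (bar_char t L r) = 0" "nat (- bar_char t L r) = 0"
    by (simp_all only: lessThan_empty_iff bot_nat_def)
  then show ?thesis by simp
qed

lemma bar_partition_core:
  assumes "odd t"
  shows "bar_partition (bar_core t L)"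
proof -
  have "t > 0" using assms by (simp add: odd_pos)
  have "finite {r + j * t | j. int j < c}" for r c
  proof (rule finite_subset)
    show "{r + j * t | j. int j < c} \<subseteq> (\<lambda>j. r + j * t) ` {..<nat c}" by auto
  qed simp
  then have "finite (bar_core t L)" by (auto simp: bar_core_def)
  moreover have "0 \<notin> bar_core t L"
  proof
    assume "0 \<in> bar_core t L"
    then have "0 \<in> bar_runner t (bar_core t L) 0" by (simp add: bar_runner_def)
    then show False by (simp add: bar_runner_core(1)[OF assms])
  qed
  ultimately show ?thesis by (simp add: bar_partition_def)
qed

lemma frobenius_quotient_component:
  assumes "finite L" "t > 0"
  shows "frobenius_arms (quotient_component t L r) = arms t L r"
    "frobenius_legs (quotient_component t L r) = legs t L r"
  using partition_of_frobenius(2,3)[OF arms_legs(1-3)[OF assms, of r]]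
  by (simp_all add: quotient_component_def arms_def legs_def)

lemma bar_runner_if_char_0:
  assumes "bar_char t L r = 0"
  shows "bar_runner t L r = arms t L r" "bar_runner t L (t - r) = legs t L r"
  using assms by (simp_all add: arms_def legs_def shifted_runner_def twisted_runner_eq bead_set_iff)

text \<open>An empty core forces all charges to vanish, so the paired runners must be the arms and
  legs of the quotient of \<open>L\<close>. A set built with these runners gives existence, and
  reading them back gives uniqueness.\<close>

lemma bar_cocore:
  assumes L: "bar_partition L" and t: "odd t"
  shows "bar_partition (bar_cocore t L)"
    and "bar_runner t (bar_cocore t L) 0 = bar_runner t L 0"
    and "r \<in> {1..(t - 1) div 2} \<Longrightarrow> bar_runner t (bar_cocore t L) r = arms t L r"
    and "r \<in> {1..(t - 1) div 2} \<Longrightarrow> bar_runner t (bar_cocore t L) (t - r) = legs t L r"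
proof -
  have "t > 0" using t by (simp add: odd_pos)
  have "finite L" using L by (simp add: bar_partition_def)
  note al = arms_legs[OF \<open>finite L\<close> \<open>t > 0\<close>]
  let ?H = "{1..(t - 1) div 2}"
  \<comment> \<open>A residue \<open>r\<close> above \<open>(t - 1) div 2\<close> is paired with
    \<open>t - r\<close>, and its runner receives the legs of that component.\<close>
  define X where "X r = (if r = 0 then bar_runner t L 0 else if r \<in> ?H then arms t L r else legs t L (t - r))" for r
  define M where "M = {l. l div t \<in> X (l mod t)}"
  have runner: "bar_runner t M r = X r" if "r < t" for r
    using that by (auto simp: bar_runner_def M_def)
  have H: "r < t" "t - r < t" "t - r \<noteq> 0" "t - r \<notin> ?H" "t - (t - r) = r" "r \<noteq> 0" if "r \<in> ?H" for r
    using that by auto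
  have M0: "bar_runner t M 0 = bar_runner t L 0"
    using runner[OF \<open>t > 0\<close>] by (simp add: X_def)
  have M_arms: "bar_runner t M r = arms t L r" if "r \<in> ?H" for r
    using runner[OF H(1)[OF that]] H(6)[OF that] that unfolding X_def by presburger
  have M_legs: "bar_runner t M (t - r) = legs t L r" if "r \<in> ?H" for r
    using runner[OF H(2)[OF that]] H(3-5)[OF that] unfolding X_def by presburger
  note M = M0 M_arms M_legs
  have fin_X: "finite (X r)" for r
    using al finite_bar_runner[OF \<open>finite L\<close> \<open>t > 0\<close>] by (simp add: X_def)
  have "M \<subseteq> (\<Union>r<t. (\<lambda>x. t * x + r) ` X r)"
  proof
    fix l assume "l \<in> M"
    then show "l \<in> (\<Union>r<t. (\<lambda>x. t * x + r) ` X r)"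
      using \<open>t > 0\<close> by (intro UN_I[of "l mod t"] image_eqI[of _ _ "l div t"]) (auto simp: M_def)
  qed
  then have "finite M" using fin_X by (auto elim: finite_subset)
  moreover have "0 \<in> bar_runner t S 0 \<longleftrightarrow> 0 \<in> S" for S by (simp add: bar_runner_def)
  then have "0 \<notin> M" using M(1) L unfolding bar_partition_def by blast
  ultimately have "bar_partition M" by (simp add: bar_partition_def)
  have char: "bar_char t M r = 0" if "r \<in> ?H" for r
    using M(2,3)[OF that] al(3) by (simp add: bar_char_def)
  then have "bar_core t M = {}" by (simp add: bar_core_def)
  have "shifted_runner t M r = shifted_runner t L r" if "r \<in> ?H" for r
    using char[OF that] M(2,3)[OF that]
    by (simp add: shifted_runner_def[of t M] twisted_runner_eq shifted_runner_eq[of t L])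
  then have "quotient_component t M r = quotient_component t L r" if "r \<in> ?H" for r
    using that by (simp add: quotient_component_def)
  then have "bar_quotient t M = bar_quotient t L"
    using M(1) by (auto simp: bar_quotient_def)
  have "bar_cocore t L = M"
    unfolding bar_cocore_def
  proof (rule the_equality)
    show "bar_partition M \<and> bar_core t M = {} \<and> bar_quotient t M = bar_quotient t L"
      by (intro conjI) fact+
    fix N assume N: "bar_partition N \<and> bar_core t N = {} \<and> bar_quotient t N = bar_quotient t L"
    then have "finite N" by (simp add: bar_partition_def)
    have quot: "quotient_component t N r = quotient_component t L r" if "r \<in> ?H" for r
    proof -
      have "\<forall>r\<in>set [1..<(t - 1) div 2 + 1]. quotient_component t N r = quotient_component t L r"
        using N unfolding bar_quotient_def prod.inject map_eq_conv by blast
      then show ?thesis using that by (metis Suc_eq_plus1 atLeastAtMost_iff atLeastLessThan_iff le_imp_less_Suc set_upt)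
    qed
    \<comment> \<open>A component determines its Frobenius symbol, which for \<open>N\<close> is the
      pair of runners itself because the charge is 0.\<close>
    have N_runners: "bar_runner t N r = arms t L r \<and> bar_runner t N (t - r) = legs t L r" if "r \<in> ?H" for r
      using bar_runner_if_char_0[OF bar_char_eq_0_if_core_empty[OF t _ that]] N
        frobenius_quotient_component[OF \<open>finite N\<close> \<open>t > 0\<close>, of r]
        frobenius_quotient_component[OF \<open>finite L\<close> \<open>t > 0\<close>, of r] quot[OF that] by simp
    have "bar_runner t N r = bar_runner t M r" if "r < t" for r
    proof -
      have "r \<in> insert 0 (?H \<union> (\<lambda>r. t - r) ` ?H)"
        using that odd_residues(1)[OF t] by (metis lessThan_iff)
      then consider "r = 0" | "r \<in> ?H" | s where "s \<in> ?H" "r = t - s" by blast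
      then show ?thesis
      proof cases
        case 1
        then show ?thesis using N M(1) by (simp add: bar_quotient_def)
      next
        case 2
        then show ?thesis using N_runners[OF 2] M(2)[OF 2] by simp
      next
        case 3
        then show ?thesis using N_runners[OF 3(1)] M(3)[OF 3(1)] by simp
      qed
    qed
    then show "N = M" using bar_runner_eqI[OF \<open>t > 0\<close>] by blast
  qed
  then show "bar_partition (bar_cocore t L)"
    "bar_runner t (bar_cocore t L) 0 = bar_runner t L 0"
    "r \<in> ?H \<Longrightarrow> bar_runner t (bar_cocore t L) r = arms t L r"
    "r \<in> ?H \<Longrightarrow> bar_runner t (bar_cocore t L) (t - r) = legs t L r"
    using M0 M_arms[of r] M_legs[of r] \<open>bar_partition M\<close> by (simp_all only:)
qed

section \<open>Comparison of sizes, lengths and signs\<close>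

lemma card_le_bar_size:
  assumes "bar_partition L"
  shows "card L \<le> bar_size L"
proof -
  have "card L = (\<Sum>l\<in>L. 1)" by simp
  also have "\<dots> \<le> \<Sum>L"
    using assms by (intro sum_mono) (auto simp: bar_partition_def Suc_le_eq intro: gr0I)
  finally show ?thesis by (simp add: bar_size_def)
qed

text \<open>The term \<open>c * (c - 1)\<close> created by a shift is twice the energy of the paired
  runners of the core.\<close>

lemma core_energy:
  "2 * (int (\<Sum>{..<nat c}) + int (\<Sum>{..<nat (- c)}) + int (nat (- c))) = c * (c - 1)"
proof -
  have "2 * int (\<Sum>{..<n}) = int n * (int n - 1)" for n
    by (induction n) (simp_all add: algebra_simps)
  from this[of "nat c"] this[of "nat (- c)"] show ?thesis
    by (cases "c \<ge> 0") (simp_all add: algebra_simps)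
qed

definition pair_count :: "nat \<Rightarrow> nat set \<Rightarrow> nat \<Rightarrow> nat" where
  "pair_count t L r = card (bar_runner t L r) + card (bar_runner t L (t - r))"

text \<open>The number \<open>D\<close> of the introduction.\<close>

definition upper_count :: "nat \<Rightarrow> nat set \<Rightarrow> nat" where
  "upper_count t L = (\<Sum>r\<in>{1..(t - 1) div 2}. card (bar_runner t L (t - r)))"

context
  fixes L :: "nat set" and t :: nat
  assumes L: "bar_partition L" and t: "odd t"
begin

private abbreviation (input) "C \<equiv> bar_core t L"
private abbreviation (input) "M \<equiv> bar_cocore t L"
private abbreviation (input) "H \<equiv> {1..(t - 1) div 2}"

private lemma t_pos: "t > 0" using t by (simp add: odd_pos)

private lemma finite_L: "finite L" using L by (simp add: bar_partition_def)

private lemma finite_C: "finite C" using bar_partition_core[OF t, of L] by (simp add: bar_partition_def)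

private lemma finite_M: "finite M" using bar_cocore(1)[OF L t] by (simp add: bar_partition_def)

text \<open>What matters later is parity: the counts for \<open>L\<close> and for its core have the
  parity of the charge, and the count for the cocore is even.\<close>

lemma pair_count_cases:
  assumes "r \<in> H"
  shows "pair_count t C r = nat \<bar>bar_char t L r\<bar>"
    "pair_count t M r = 2 * card (legs t L r)"
    "int (pair_count t L r) = bar_char t L r + 2 * int (card (bar_runner t L (t - r)))"
  using bar_runner_core(2,3)[OF t assms] bar_cocore(3,4)[OF L t assms] arms_legs(3)[OF finite_L t_pos]
  by (auto simp: pair_count_def bar_char_def)

text \<open>Paired runners contribute \<open>t\<close> times their energy plus \<open>r\<close>
  times their charge. The energy splits by \<open>arms_legs\<close>, and the charge belongs to the
  core alone.\<close>

lemma bar_size_core_cocore: "bar_size L = bar_size C + bar_size M"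
proof -
  define w where "w r X Y = (\<Sum>x\<in>X. int (t * x + r)) + (\<Sum>y\<in>Y. int (t * y + (t - r)))" for r X Y
  have size: "int (bar_size S) = (\<Sum>x\<in>bar_runner t S 0. int (t * x))
      + (\<Sum>r\<in>H. w r (bar_runner t S r) (bar_runner t S (t - r)))" if "finite S" for S
    using sum.bar_runners[OF that t, of int] by (simp add: bar_size_def w_def)
  \<comment> \<open>A part on the second runner is \<open>t * (y + 1) - r\<close>, whence the term
    \<open>card Y\<close> in the energy and the minus sign in the charge.\<close>
  have w: "w r X Y = int t * (int (\<Sum>X) + int (\<Sum>Y) + int (card Y)) + int r * (int (card X) - int (card Y))"
    if "r \<in> H" for r X Y
  proof -
    have "int (t - r) = int t - int r" using that by auto
    then show ?thesis
      by (simp add: w_def sum.distrib sum_subtractf sum_distrib_left algebra_simps)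
  qed
  have "w r (bar_runner t L r) (bar_runner t L (t - r))
      = w r (bar_runner t C r) (bar_runner t C (t - r)) + w r (bar_runner t M r) (bar_runner t M (t - r))"
    if r: "r \<in> H" for r
  proof -
    define c where "c = bar_char t L r"
    have "int (card (bar_runner t L r)) - int (card (bar_runner t L (t - r))) = c"
      by (simp add: c_def bar_char_def)
    moreover have "2 * (int (\<Sum>(bar_runner t L r)) + int (\<Sum>(bar_runner t L (t - r))) + int (card (bar_runner t L (t - r))))
       = 2 * (int (\<Sum>(arms t L r)) + int (\<Sum>(legs t L r)) + int (card (legs t L r)))
         + 2 * (int (\<Sum>{..<nat c}) + int (\<Sum>{..<nat (- c)}) + int (nat (- c)))"
      unfolding core_energy c_def by (rule arms_legs(4)[OF finite_L t_pos])
    then have "int (\<Sum>(bar_runner t L r)) + int (\<Sum>(bar_runner t L (t - r))) + int (card (bar_runner t L (t - r)))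
       = (int (\<Sum>(arms t L r)) + int (\<Sum>(legs t L r)) + int (card (legs t L r)))
         + (int (\<Sum>{..<nat c}) + int (\<Sum>{..<nat (- c)}) + int (nat (- c)))"
      by simp
    moreover have "int (nat c) - int (nat (- c)) = c" by simp
    moreover have "card (arms t L r) = card (legs t L r)" by (rule arms_legs(3)[OF finite_L t_pos])
    ultimately show ?thesis
      unfolding bar_runner_core(2,3)[OF t r] bar_cocore(3,4)[OF L t r] w[OF r] c_def[symmetric] card_lessThan
      by (simp only: ring_distribs diff_self mult_zero_right add_0_right add_ac)
  qed
  then have "int (bar_size L) = int (bar_size C) + int (bar_size M)"
    unfolding size[OF finite_L] size[OF finite_C] size[OF finite_M] bar_runner_core(1)[OF t] bar_cocore(2)[OF L t]
    by (simp add: sum.distrib)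
  then show ?thesis by simp
qed

text \<open>The length minus twice \<open>upper_count\<close> is the length of runner 0 plus the sum
  of the charges, which is additive.\<close>

lemma card_core_cocore:
  "card L + 2 * (upper_count t C + upper_count t M) = card C + card M + 2 * upper_count t L"
proof -
  have card: "card S = card (bar_runner t S 0) + (\<Sum>r\<in>H. pair_count t S r)" if "finite S" for S
    using sum.bar_runners[OF that t, of "\<lambda>_. 1::nat"] by (simp add: pair_count_def)
  have "pair_count t L r + 2 * (card (bar_runner t C (t - r)) + card (bar_runner t M (t - r)))
      = pair_count t C r + pair_count t M r + 2 * card (bar_runner t L (t - r))" if "r \<in> H" for r
    using pair_count_cases[OF that] bar_runner_core(3)[OF t that, of L] bar_cocore(4)[OF L t that] by simp
  then have "(\<Sum>r\<in>H. pair_count t L r + 2 * (card (bar_runner t C (t - r)) + card (bar_runner t M (t - r))))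
      = (\<Sum>r\<in>H. pair_count t C r + pair_count t M r + 2 * card (bar_runner t L (t - r)))"
    by simp
  then show ?thesis
    unfolding card[OF finite_L] card[OF finite_C] card[OF finite_M] bar_runner_core(1)[OF t] bar_cocore(2)[OF L t]
    by (simp add: upper_count_def sum.distrib sum_distrib_left)
qed

text \<open>Once the factors \<open>u\<close> are split off, only the parity of each
  \<open>pair_count\<close> matters, and it is the same for \<open>L\<close> as for core and cocore
  together.\<close>

lemma prod_core_cocore:
  fixes g \<chi> :: "nat \<Rightarrow> int" and u :: int
  assumes "u * u = 1" and \<chi>: "\<And>r. r \<in> H \<Longrightarrow> \<chi> r * \<chi> r = 1"
    and g: "\<And>r x. r \<in> H \<Longrightarrow> g (t * x + r) = \<chi> r" "\<And>r x. r \<in> H \<Longrightarrow> g (t * x + (t - r)) = u * \<chi> r"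
  shows "prod g L * u ^ upper_count t L = prod g C * prod g M * u ^ (upper_count t C + upper_count t M)"
proof -
  define Q where "Q S = (\<Prod>r\<in>H. \<chi> r ^ pair_count t S r)" for S
  have even_power: "u ^ (k + k) = 1" for k
    using assms(1) by (simp add: power_add flip: power_mult_distrib)
  \<comment> \<open>The product contains \<open>u\<close> to the power
    \<open>upper_count t S\<close>; multiplying by the same power again removes it.\<close>
  have prod: "prod g S * u ^ upper_count t S = (\<Prod>x\<in>bar_runner t S 0. g (t * x)) * Q S" if "finite S" for S
  proof -
    have "(\<Prod>x\<in>bar_runner t S r. g (t * x + r)) * (\<Prod>x\<in>bar_runner t S (t - r). g (t * x + (t - r)))
        = u ^ card (bar_runner t S (t - r)) * \<chi> r ^ pair_count t S r" if "r \<in> H" for r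
      by (simp only: g[OF that] prod_constant power_mult_distrib pair_count_def power_add) (simp only: mult_ac)
    then have "prod g S = (\<Prod>x\<in>bar_runner t S 0. g (t * x)) *
        (\<Prod>r\<in>H. u ^ card (bar_runner t S (t - r)) * \<chi> r ^ pair_count t S r)"
      unfolding prod.bar_runners[OF that t, of g] by simp
    also have "(\<Prod>r\<in>H. u ^ card (bar_runner t S (t - r)) * \<chi> r ^ pair_count t S r) = u ^ upper_count t S * Q S"
      by (simp add: Q_def upper_count_def prod.distrib power_sum)
    finally show ?thesis
      using even_power[of "upper_count t S"] by (simp add: power_add mult_ac)
  qed
  have "\<chi> r ^ pair_count t L r = \<chi> r ^ pair_count t C r * \<chi> r ^ pair_count t M r" if "r \<in> H" for r
  proof (cases "\<chi> r = 1")
    case False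
    then have "\<chi> r = - 1" using \<chi>[OF that] by (metis square_eq_1_iff)
    moreover have "even (pair_count t L r) \<longleftrightarrow> even (pair_count t C r + pair_count t M r)"
    proof -
      have "even (int (pair_count t L r)) \<longleftrightarrow> even (bar_char t L r)"
        unfolding pair_count_cases(3)[OF that] by simp
      moreover have "even (nat \<bar>bar_char t L r\<bar>) \<longleftrightarrow> even (bar_char t L r)"
        by (simp add: even_nat_iff)
      ultimately show ?thesis using pair_count_cases(1,2)[OF that] by simp
    qed
    ultimately show ?thesis by (simp add: minus_one_power_iff flip: power_add)
  qed simp
  then have "Q L = Q C * Q M" by (simp add: Q_def prod.distrib)
  moreover have "(\<Prod>x\<in>bar_runner t L 0. g (t * x)) * Q L * 1
     = (\<Prod>x\<in>bar_runner t C 0. g (t * x)) * Q C * ((\<Prod>x\<in>bar_runner t M 0. g (t * x)) * Q M)"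
    using \<open>Q L = Q C * Q M\<close> by (simp add: bar_runner_core(1)[OF t] bar_cocore(2)[OF L t])
  moreover have "prod g C * prod g M * u ^ (upper_count t C + upper_count t M)
      = (prod g C * u ^ upper_count t C) * (prod g M * u ^ upper_count t M)"
    by (simp add: power_add mult_ac)
  ultimately show ?thesis
    unfolding prod[OF finite_L] prod[OF finite_C] prod[OF finite_M] by simp
qed

end

section \<open>Rounding of the exponents and assembly of the signs\<close>

lemma sign_bookkeeping:
  fixes u s :: int
  assumes u: "u * u = 1" and s: "s * s = 1"
    and n: "nl + 2 * dl = nc + nm + 2 * dq" and P: "pl * u ^ dl = pq * u ^ dq"
  defines "T \<equiv> \<lambda>n. if odd n then s * u ^ ((n + 1) div 2) else u ^ (n div 2)"
  shows "T nl * pl = (if odd nc \<and> odd nm then u else 1) * T nc * T nm * pq"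
proof -
  \<comment> \<open>For even \<open>n\<close> rounding \<open>n / 2\<close> up changes nothing, so
    both branches share one exponent.\<close>
  have T: "T n = (if odd n then s else 1) * u ^ ((n + 1) div 2)" for n
    by (auto simp: T_def)
  have even_power: "u ^ (k + k) = 1" for k
    using u by (simp add: power_add flip: power_mult_distrib)
  have "pl = pl * u ^ (dl + dl)" by (simp only: even_power mult_1_right)
  also have "\<dots> = pq * u ^ dq * u ^ dl" unfolding power_add mult.assoc[symmetric] P ..
  finally have pl: "pl = pq * u ^ (dq + dl)" by (simp add: power_add)
  have "odd nl \<longleftrightarrow> odd (nc + nm)" using n by presburger
  then have units: "(if odd nl then s else 1) = (if odd nc then s else 1) * (if odd nm then s else 1)"
    using s by (cases "odd nc"; cases "odd nm") simp_all
  have powers: "u ^ ((nl + 1) div 2) * u ^ (dq + dl)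
      = (if odd nc \<and> odd nm then u else 1) * u ^ ((nc + 1) div 2) * u ^ ((nm + 1) div 2)"
  proof -
    have "(nl + 1) div 2 + dl = (nl + 2 * dl + 1) div 2" by simp
    also have "\<dots> = (nc + nm + 1) div 2 + dq" unfolding n by simp
    finally have "(nl + 1) div 2 + (dq + dl) = (nc + nm + 1) div 2 + (dq + dq)" by simp
    then have "u ^ ((nl + 1) div 2) * u ^ (dq + dl) = u ^ ((nc + nm + 1) div 2)"
      using even_power[of dq] by (metis mult_1_right power_add)
    also have "\<dots> = (if odd nc \<and> odd nm then u else 1) * u ^ ((nc + 1) div 2) * u ^ ((nm + 1) div 2)"
    proof (cases "odd nc \<and> odd nm")
      case True
      \<comment> \<open>Two odd numbers are each rounded up while their even sum is not; this is the
        origin of the extra \<open>u\<close>.\<close>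
      then have "(nc + 1) div 2 + (nm + 1) div 2 = Suc ((nc + nm + 1) div 2)" by presburger
      then have "u ^ ((nc + 1) div 2) * u ^ ((nm + 1) div 2) = u * u ^ ((nc + nm + 1) div 2)"
        by (metis power_Suc power_add)
      then have "u * (u ^ ((nc + 1) div 2) * u ^ ((nm + 1) div 2)) = u ^ ((nc + nm + 1) div 2)"
        using u by (metis mult.assoc mult_1)
      then show ?thesis unfolding if_P[OF True] mult.assoc by (rule sym)
    next
      case False
      then have "(nc + 1) div 2 + (nm + 1) div 2 = (nc + nm + 1) div 2" by presburger
      then show ?thesis unfolding if_not_P[OF False] by (simp only: mult_1 flip: power_add)
    qed
    finally show ?thesis .
  qed
  have "T nl * pl = (if odd nl then s else 1) * (u ^ ((nl + 1) div 2) * u ^ (dq + dl)) * pq"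
    unfolding T pl by (simp only: mult_ac)
  then show ?thesis
    unfolding units powers T by (simp only: mult_ac)
qed

text \<open>The common form of all cases, with \<open>\<chi>\<close> either the Legendre symbol or
  the constant 1. The parts divisible by \<open>t\<close> contribute the same factor to
  \<open>L\<close> and to its cocore.\<close>

lemma (in galois_automorphism) tau_core_cocore:
  fixes L :: "nat set" and t :: nat and \<chi> :: "nat \<Rightarrow> int"
  assumes L: "bar_partition L" and t: "odd t"
    and \<chi>: "\<And>r x. r \<in> {1..(t - 1) div 2} \<Longrightarrow> sqrt_sign (t * x + r) = \<chi> r"
      "\<And>r x. r \<in> {1..(t - 1) div 2} \<Longrightarrow> sqrt_sign (t * x + (t - r)) = ii_sign * \<chi> r"
  shows "tau L f = (if bar_sgn (bar_core t L) = - 1 \<and> bar_sgn (bar_cocore t L) = - 1 then ii_sign else 1)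
    * tau (bar_core t L) f * tau (bar_cocore t L) f"
proof -
  let ?C = "bar_core t L" and ?M = "bar_cocore t L"
  define N where "N S = bar_size S - card S" for S
  define T where "T n = (if odd n then sqrt_sign 2 * ii_sign ^ ((n + 1) div 2) else ii_sign ^ (n div 2))" for n
  note C = bar_partition_core[OF t, of L]
  note M = bar_cocore(1)[OF L t]
  have ii: "ii_sign * ii_sign = 1" using ii_sign_cases by auto
  have sqrt2: "sqrt_sign 2 * sqrt_sign 2 = 1" using sqrt_sign_cases[of 2] by auto
  have "\<chi> r * \<chi> r = 1" if "r \<in> {1..(t - 1) div 2}" for r
    using \<chi>(1)[OF that, of 0] sqrt_sign_cases[of "t * 0 + r"] by auto
  then have prod: "(\<Prod>l\<in>L. sqrt_sign l) * ii_sign ^ upper_count t L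
      = (\<Prod>l\<in>?C. sqrt_sign l) * (\<Prod>l\<in>?M. sqrt_sign l) * ii_sign ^ (upper_count t ?C + upper_count t ?M)"
    using ii \<chi> by (intro prod_core_cocore[OF L t, where \<chi> = \<chi>]) auto
  \<comment> \<open>The length never exceeds the size, so the differences \<open>N\<close> are not
    truncated.\<close>
  have "N L + 2 * upper_count t L = N ?C + N ?M + 2 * (upper_count t ?C + upper_count t ?M)"
    using bar_size_core_cocore[OF L t] card_core_cocore[OF L t]
      card_le_bar_size[OF L] card_le_bar_size[OF C] card_le_bar_size[OF M] unfolding N_def by linarith
  from sign_bookkeeping[OF ii sqrt2 this prod, folded T_def]
  show ?thesis
    unfolding tau_eq[OF L] tau_eq[OF C] tau_eq[OF M] bar_sgn_eq_iff N_def[symmetric] T_def[symmetric]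
    by (simp only: mult_ac)
qed

lemma dvd_part_residue:
  fixes p r x :: nat
  assumes "r \<in> {1..(p - 1) div 2}"
  shows "\<not> p dvd p * x + r" "\<not> p dvd p * x + (p - r)" "p * x + r > 0" "p * x + (p - r) > 0"
proof -
  have "0 < r" "r < p" "0 < p - r" "p - r < p" using assms by auto
  moreover have "\<not> p dvd p * x + s" if "0 < s" "s < p" for s
    using that by (metis dvd_add_right_iff dvd_triv_left nat_dvd_not_less)
  ultimately show "\<not> p dvd p * x + r" "\<not> p dvd p * x + (p - r)" "p * x + r > 0" "p * x + (p - r) > 0"
    by blast+
qed

theorem theorem4p3:
  fixes p :: nat and L :: "nat set"
  assumes "prime p" and "odd p" and "bar_partition L"
  shows
    "(\<forall>\<sigma>. is_sigma p \<sigma> \<longrightarrow>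
        (bar_sgn (bar_core p L) = 1 \<or> bar_sgn (bar_cocore p L) = 1 \<longrightarrow>
           tau L \<sigma> = tau (bar_core p L) \<sigma> * tau (bar_cocore p L) \<sigma>) \<and>
        (bar_sgn (bar_core p L) = -1 \<and> bar_sgn (bar_cocore p L) = -1 \<longrightarrow>
           tau L \<sigma> = (-1) ^ ((p - 1) div 2) * tau (bar_core p L) \<sigma> * tau (bar_cocore p L) \<sigma>)) \<and>
     (\<forall>f. galois_aut f \<and> (\<forall>z. p'_root_of_unity p z \<longrightarrow> f z = z) \<longrightarrow>
        tau L f = tau (bar_core p L) f * tau (bar_cocore p L) f)"
proof (intro conjI allI impI)
  have "p > 2" using assms(1,2) prime_ge_2_nat[of p] by (cases "p = 2") auto
  fix \<sigma> assume sigma: "is_sigma p \<sigma>"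
  interpret galois_automorphism \<sigma> using sigma by unfold_locales (simp add: is_sigma_def)
  note sqrt_sign = sigma_sqrt_sign[OF sigma assms(1,2)]
  have "sqrt_sign (p * x + r) = Legendre r p" if "r \<in> {1..(p - 1) div 2}" for r x
    using sqrt_sign[OF dvd_part_residue(3,1)[OF that]] by (simp add: Legendre_cong[of "int p * _ + _"] cong_def)
  moreover have "sqrt_sign (p * x + (p - r)) = ii_sign * Legendre r p" if "r \<in> {1..(p - 1) div 2}" for r x
  proof -
    \<comment> \<open>The residue is that of \<open>- r\<close>, and the symbol of -1 is the sign of
      \<open>\<i>\<close>.\<close>
    have "int (p * x + (p - r)) = - 1 * int r + int p * (int x + 1)"
      using that by (auto simp: algebra_simps)
    then have "Legendre (p * x + (p - r)) p = Legendre (- 1 * int r) p"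
      by (intro Legendre_cong) (simp only: cong_iff_dvd_diff add_diff_cancel_left' dvd_triv_left)
    also have "\<dots> = ii_sign * Legendre r p"
      using Legendre_mult[OF assms(1) \<open>p > 2\<close>, of "- 1" r] Legendre_minus_1[OF assms(1) \<open>p > 2\<close>]
        sigma_ii_sign[OF sigma assms(2)] by simp
    finally show ?thesis using sqrt_sign[OF dvd_part_residue(4,2)[OF that]] by simp
  qed
  ultimately have tau: "tau L \<sigma> = (if bar_sgn (bar_core p L) = - 1 \<and> bar_sgn (bar_cocore p L) = - 1
      then ii_sign else 1) * tau (bar_core p L) \<sigma> * tau (bar_cocore p L) \<sigma>"
    by (rule tau_core_cocore[OF assms(3,2)])
  show "tau L \<sigma> = tau (bar_core p L) \<sigma> * tau (bar_cocore p L) \<sigma>"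
    if "bar_sgn (bar_core p L) = 1 \<or> bar_sgn (bar_cocore p L) = 1"
    using tau that by auto
  show "tau L \<sigma> = (-1) ^ ((p - 1) div 2) * tau (bar_core p L) \<sigma> * tau (bar_cocore p L) \<sigma>"
    if "bar_sgn (bar_core p L) = -1 \<and> bar_sgn (bar_cocore p L) = -1"
    using tau that sigma_ii_sign[OF sigma assms(2)] by simp
next
  fix f assume f: "galois_aut f \<and> (\<forall>z. p'_root_of_unity p z \<longrightarrow> f z = z)"
  interpret galois_automorphism f using f by unfold_locales simp
  have ii: "ii_sign = 1"
    using f p'_root_of_unity_ii[OF assms(2)] by (simp add: ii_sign_def)
  \<comment> \<open>Here \<open>\<chi>\<close> is constantly 1, and so is the sign of
    \<open>\<i>\<close>.\<close>
  have "sqrt_sign (p * x + r) = 1" "sqrt_sign (p * x + (p - r)) = ii_sign * 1"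
    if "r \<in> {1..(p - 1) div 2}" for r x
    using sqrt_sign_if_trivial[OF assms(1,2)] f dvd_part_residue[OF that] ii by simp_all
  then have "tau L f = (if bar_sgn (bar_core p L) = - 1 \<and> bar_sgn (bar_cocore p L) = - 1 then ii_sign else 1)
      * tau (bar_core p L) f * tau (bar_cocore p L) f"
    by (rule tau_core_cocore[OF assms(3,2)])
  then show "tau L f = tau (bar_core p L) f * tau (bar_cocore p L) f" by (simp add: ii)
qed

end
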